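(* The following are provable in $\mathbf{ZF}$: (1) A topological space $\mathbf{X}$ is a $P$-space if and only if every $G_\delta$-set of $\mathbf{X}$ is open in $\mathbf{X}$. In particular, if $\mathbf{X}$ is a $P$-space, then every zero-set of $\mathbf{X}$ (so also every $c_\delta$-set of $\mathbf{X}$) is open in $\mathbf{X}$. (2) Every subspace of a $P$-space is a $P$-space. (3) Every direct sum of $P$-spaces is a $P$-space. (4) Every completely regular $P$-space is strongly zero-dimensional. (5) If $\mathbf{X}$ is a $P$-space, then $C(\mathbf{X},\mathbb{R}_{disc})=C(\mathbf{X})$. (6) A $P$-space is Baire if and only if it is strongly Baire. (7) If a $T_1$-space $\mathbf{X}$ contains a cuf set $Y$ which has an accumulation point in $\mathbf{X}$, then $\mathbf{X}$ is not a $P$-space. (8) If a $T_1$-space $\mathbf{X}$ is a $P$-space, then every cuf subspace of $\mathbf{X}$ is closed and discrete. (9) Every topological space whose underlying set is weakly Dedekind-finite is a $P$-space. (10) If $X$ is an infinite quasi Dedekind-finite set, then, for any element $\infty\notin X$, the one-point compactification $\mathbf{X}(\infty)$ of the discrete space $X_{disc}$ is a Tychonoff $P$-space. (11) If a first-countable $T_1$-space is a $P$-space, it is discrete. In particular, every metrizable $P$-space is discrete. (12) A topological space $\mathbf{X}=\langle X,\tau\rangle$ is a $P$-space if and only if the base $\mathcal{B}=\tau\setminus\{\emptyset\}$ is almost stable under countable intersections. (13) If a $T_1$-space $\mathbf{X}$ is a $P$-space, then every countable subspace of $\mathbf{X}$ is discrete and closed in $\mathbf{X}$. In particular, if a separable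 $T_1$-space is a $P$-space, it is discrete and countable.
   Context: The base theory is $\mathbf{ZF}$ (no Axiom of Choice). A set is countable if it is equipotent to a subset of $\omega$; denumerable means infinite and countable. A set is Dedekind-infinite if it is equipotent to a proper subset of itself. A set $X$ is weakly Dedekind-finite if its power set is not Dedekind-infinite, and quasi Dedekind-finite if the set $[X]^{<\omega}$ of its finite subsets is not Dedekind-infinite. A cuf set is a set which is a countable union of finite sets (a cuf subspace is a subspace whose underlying set is a cuf set). A point $x$ of a topological space $\mathbf{X}$ is a $P$-point if every $G_\delta$-set $U$ of $\mathbf{X}$ with $x\in U$ satisfies $x\in\mathrm{int}_{\mathbf{X}}(U)$; $\mathbf{X}$ is a $P$-space if all its points are $P$-points (no separation axioms assumed). $C(\mathbf{X})$ is the set of continuous functions from $\mathbf{X}$ to $\mathbb{R}$ with its natural topology; $C(\mathbf{X},\mathbb{R}_{disc})$ is the set of functions continuous into $\mathbb{R}$ with the discrete topology. A zero-set is a set $f^{-1}[\{0\}]$, $f\in C(\mathbf{X})$; a co-zero set is the complement of a zero-set; a $c_\delta$-set is the intersection of a non-empty countable family of clopen sets. $\mathbf{X}$ is completely regular if its co-zero sets form a base; Tychonoff means completely regular and $T_1$; strongly zero-dimensional means completely regular and such that for all disjoint zero-sets $Z_1,Z_2$ there is a clopen $U$ with $Z_1\subseteq U\subseteq X\setminus Z_2$. $\mathbf{X}$ is Baire (respectively, strongly Baire) if for every denumerable family $\mathcal{U}$ of dense open subsets of $\mathbf{X}$, $\bigcap\mathcal{U}$ is dense (respectively, open and dense) in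 $\mathbf{X}$. A base $\mathcal{B}$ is almost stable under countable intersections if the intersection of every non-empty countable subfamily of $\mathcal{B}\cup\{\emptyset\}$ belongs to $\mathcal{B}\cup\{\emptyset\}$. For an infinite set $X$ and $\infty\notin X$, $\mathbf{X}(\infty)$ is the set $X\cup\{\infty\}$ with topology $\mathcal{P}(X)\cup\{(X\cup\{\infty\})\setminus F: F\subseteq X\text{ finite}\}$. *)

theory Defs
  imports "HOL-Algebra.Ring"
begin

section \<open>Models of ZF\<close>

text \<open>
  HOL has a choice operator, so a theorem about HOL sets says nothing about provability in ZF
  without the Axiom of Choice. Provability in ZF is therefore rendered as truth in every model of
  the first-order theory ZF. Separation and Replacement are restricted to first-order formulas:
  with arbitrary HOL predicates, the choice operator of HOL would give the Axiom of Choice inside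
  the model.

  For the same reason, below this section every quantifier ranges over elements of the model. A
  HOL set of elements only occurs as the extension of an element or as an explicitly written
  comprehension, so that every notion abbreviates a first-order formula in the membership relation.
\<close>

text \<open>Formulas of the language of set theory, with de Bruijn indices; index 0 is the innermost bound variable.\<close>

datatype fm = Mem nat nat | Eq nat nat | Neg fm | Conj fm fm | Ex fm

primrec sat :: "('v \<Rightarrow> 'v set) \<Rightarrow> fm \<Rightarrow> (nat \<Rightarrow> 'v) \<Rightarrow> bool" where
  "sat el (Mem i j) e \<longleftrightarrow> e i \<in> el (e j)"
| "sat el (Eq i j) e \<longleftrightarrow> e i = e j"
| "sat el (Neg p) e \<longleftrightarrow> \<not> sat el p e"
| "sat el (Conj p q) e \<longleftrightarrow> sat el p e \<and> sat el q e"
| "sat el (Ex p) e \<longleftrightarrow> (\<exists>x. sat el p (case_nat x e))"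

text \<open>The whole type is the universe of the model; \<open>x \<in> elts y\<close> is its membership relation.\<close>

class zf =
  fixes elts :: "'a \<Rightarrow> 'a set"
  assumes extensionality: "elts x = elts y \<Longrightarrow> x = y"
    and foundation: "elts x \<noteq> {} \<Longrightarrow> \<exists>y\<in>elts x. elts y \<inter> elts x = {}"
    and pairing: "\<exists>z. elts z = {x, y}"
    and union: "\<exists>u. elts u = (\<Union>y\<in>elts x. elts y)"
    and power_set: "\<exists>p. elts p = {y. elts y \<subseteq> elts x}"
    and infinity: "\<exists>w. (\<exists>z\<in>elts w. elts z = {}) \<and>
                      (\<forall>x\<in>elts w. \<exists>y\<in>elts w. elts y = insert x (elts x))"
    and separation: "\<exists>y. elts y = {z \<in> elts x. sat elts p (case_nat z e)}"
    and replacement: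
      "(\<And>x y y'. x \<in> elts a \<Longrightarrow> sat elts p (case_nat x (case_nat y e)) \<Longrightarrow>
          sat elts p (case_nat x (case_nat y' e)) \<Longrightarrow> y = y') \<Longrightarrow>
       \<exists>b. elts b = {y. \<exists>x\<in>elts a. sat elts p (case_nat x (case_nat y e))}"


section \<open>Basic set theory inside the model\<close>

text \<open>The element of the model with extension \<open>A\<close>; only meaningful if there is one.\<close>

definition vset :: "'v::zf set \<Rightarrow> 'v" where
  "vset A = (THE x. elts x = A)"

lemma elts_vset: "elts x = A \<Longrightarrow> elts (vset A) = A"
  unfolding vset_def by (rule theI[where a = x]) (auto intro: extensionality)

definition vempty :: "'v::zf" where
  "vempty = vset {}"

definition vpair :: "'v::zf \<Rightarrow> 'v \<Rightarrow> 'v" where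
  "vpair x y = vset {vset {x}, vset {x, y}}"

definition vtimes :: "'v::zf \<Rightarrow> 'v \<Rightarrow> 'v" where
  "vtimes A B = vset {p. \<exists>x\<in>elts A. \<exists>y\<in>elts B. p = vpair x y}"

definition vPow :: "'v::zf \<Rightarrow> 'v" where
  "vPow A = vset {B. elts B \<subseteq> elts A}"

definition vfun :: "'v::zf \<Rightarrow> 'v \<Rightarrow> 'v \<Rightarrow> bool" where
  "vfun f A B \<longleftrightarrow> elts f \<subseteq> elts (vtimes A B) \<and> (\<forall>x\<in>elts A. \<exists>!y. vpair x y \<in> elts f)"

definition app :: "'v::zf \<Rightarrow> 'v \<Rightarrow> 'v" where
  "app f x = (THE y. vpair x y \<in> elts f)"

definition vinductive :: "'v::zf \<Rightarrow> bool" where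
  "vinductive w \<longleftrightarrow> (\<exists>z\<in>elts w. elts z = {}) \<and>
     (\<forall>x\<in>elts w. \<exists>y\<in>elts w. elts y = insert x (elts x))"

definition omega :: "'v::zf" where
  "omega = vset {n. \<forall>w. vinductive w \<longrightarrow> n \<in> elts w}"

definition equipotent :: "'v::zf \<Rightarrow> 'v \<Rightarrow> bool" where
  "equipotent A B \<longleftrightarrow> (\<exists>f. vfun f A B \<and> bij_betw (app f) (elts A) (elts B))"

definition vfinite :: "'v::zf \<Rightarrow> bool" where
  "vfinite A \<longleftrightarrow> (\<exists>n\<in>elts omega. equipotent A n)"

definition vcountable :: "'v::zf \<Rightarrow> bool" where
  "vcountable A \<longleftrightarrow> (\<exists>S. elts S \<subseteq> elts omega \<and> equipotent A S)"

definition denumerable :: "'v::zf \<Rightarrow> bool" where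
  "denumerable A \<longleftrightarrow> \<not> vfinite A \<and> vcountable A"

definition dedekind_infinite :: "'v::zf \<Rightarrow> bool" where
  "dedekind_infinite A \<longleftrightarrow> (\<exists>B. elts B \<subset> elts A \<and> equipotent A B)"

definition weakly_dedekind_finite :: "'v::zf \<Rightarrow> bool" where
  "weakly_dedekind_finite A \<longleftrightarrow> \<not> dedekind_infinite (vPow A)"

definition finite_subsets :: "'v::zf \<Rightarrow> 'v" where
  "finite_subsets A = vset {F. elts F \<subseteq> elts A \<and> vfinite F}"

definition quasi_dedekind_finite :: "'v::zf \<Rightarrow> bool" where
  "quasi_dedekind_finite A \<longleftrightarrow> \<not> dedekind_infinite (finite_subsets A)"

definition cuf :: "'v::zf \<Rightarrow> bool" where
  "cuf A \<longleftrightarrow> (\<exists>\<F>. vcountable \<F> \<and> (\<forall>F\<in>elts \<F>. vfinite F) \<and> elts A = (\<Union>F\<in>elts \<F>. elts F))"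


section \<open>The real line inside the model\<close>

text \<open>
  The real numbers of the model are any complete ordered field of the model: ZF proves that there
  is one, and that it is unique up to isomorphism. Completeness only concerns those subsets that
  are elements of the model.
\<close>

record 'v real_struct =
  rcarrier :: 'v
  rplus :: 'v
  rtimes :: 'v
  rzero :: 'v
  rone :: 'v
  rless :: 'v

definition radd :: "'v::zf real_struct \<Rightarrow> 'v \<Rightarrow> 'v \<Rightarrow> 'v" where
  "radd R x y = app (rplus R) (vpair x y)"

definition rmult :: "'v::zf real_struct \<Rightarrow> 'v \<Rightarrow> 'v \<Rightarrow> 'v" where
  "rmult R x y = app (rtimes R) (vpair x y)"

definition rlt :: "'v::zf real_struct \<Rightarrow> 'v \<Rightarrow> 'v \<Rightarrow> bool" where
  "rlt R x y \<longleftrightarrow> vpair x y \<in> elts (rless R)"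

definition rle :: "'v::zf real_struct \<Rightarrow> 'v \<Rightarrow> 'v \<Rightarrow> bool" where
  "rle R x y \<longleftrightarrow> rlt R x y \<or> x = y"

definition rring :: "'v::zf real_struct \<Rightarrow> 'v ring" where
  "rring R = \<lparr>carrier = elts (rcarrier R), mult = rmult R, one = rone R,
              zero = rzero R, add = radd R\<rparr>"

definition complete_ordered_field :: "'v::zf real_struct \<Rightarrow> bool" where
  "complete_ordered_field R \<longleftrightarrow>
     vfun (rplus R) (vtimes (rcarrier R) (rcarrier R)) (rcarrier R) \<and>
     vfun (rtimes R) (vtimes (rcarrier R) (rcarrier R)) (rcarrier R) \<and>
     elts (rless R) \<subseteq> elts (vtimes (rcarrier R) (rcarrier R)) \<and>
     field (rring R) \<and>
     (\<forall>x\<in>elts (rcarrier R). \<not> rlt R x x) \<and>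
     (\<forall>x\<in>elts (rcarrier R). \<forall>y\<in>elts (rcarrier R). \<forall>z\<in>elts (rcarrier R).
        rlt R x y \<longrightarrow> rlt R y z \<longrightarrow> rlt R x z) \<and>
     (\<forall>x\<in>elts (rcarrier R). \<forall>y\<in>elts (rcarrier R). rlt R x y \<or> x = y \<or> rlt R y x) \<and>
     (\<forall>x\<in>elts (rcarrier R). \<forall>y\<in>elts (rcarrier R). \<forall>z\<in>elts (rcarrier R).
        rlt R x y \<longrightarrow> rlt R (radd R x z) (radd R y z)) \<and>
     (\<forall>x\<in>elts (rcarrier R). \<forall>y\<in>elts (rcarrier R).
        rlt R (rzero R) x \<longrightarrow> rlt R (rzero R) y \<longrightarrow> rlt R (rzero R) (rmult R x y)) \<and>
     (\<forall>S. elts S \<subseteq> elts (rcarrier R) \<and> elts S \<noteq> {} \<and>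
          (\<exists>b\<in>elts (rcarrier R). \<forall>x\<in>elts S. rle R x b) \<longrightarrow>
        (\<exists>s\<in>elts (rcarrier R). (\<forall>x\<in>elts S. rle R x s) \<and>
           (\<forall>b\<in>elts (rcarrier R). (\<forall>x\<in>elts S. rle R x b) \<longrightarrow> rle R s b)))"

definition real_topology :: "'v::zf real_struct \<Rightarrow> 'v" where
  "real_topology R = vset {U. elts U \<subseteq> elts (rcarrier R) \<and>
     (\<forall>x\<in>elts U. \<exists>a\<in>elts (rcarrier R). \<exists>b\<in>elts (rcarrier R). rlt R a x \<and> rlt R x b \<and>
        {y \<in> elts (rcarrier R). rlt R a y \<and> rlt R y b} \<subseteq> elts U)}"


section \<open>Topological spaces inside the model\<close>

definition vopen :: "'v::zf \<Rightarrow> 'v set \<Rightarrow> bool" where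
  "vopen \<tau> A \<longleftrightarrow> (\<exists>U\<in>elts \<tau>. elts U = A)"

definition is_topology :: "'v::zf \<Rightarrow> 'v \<Rightarrow> bool" where
  "is_topology X \<tau> \<longleftrightarrow>
     (\<forall>U\<in>elts \<tau>. elts U \<subseteq> elts X) \<and> vopen \<tau> {} \<and> X \<in> elts \<tau> \<and>
     (\<forall>U\<in>elts \<tau>. \<forall>V\<in>elts \<tau>. vopen \<tau> (elts U \<inter> elts V)) \<and>
     (\<forall>\<U>. elts \<U> \<subseteq> elts \<tau> \<longrightarrow> vopen \<tau> (\<Union>U\<in>elts \<U>. elts U))"

definition vclosed :: "'v::zf \<Rightarrow> 'v \<Rightarrow> 'v \<Rightarrow> bool" where
  "vclosed X \<tau> A \<longleftrightarrow> elts A \<subseteq> elts X \<and> vopen \<tau> (elts X - elts A)"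

definition clopen :: "'v::zf \<Rightarrow> 'v \<Rightarrow> 'v \<Rightarrow> bool" where
  "clopen X \<tau> U \<longleftrightarrow> U \<in> elts \<tau> \<and> vclosed X \<tau> U"

definition interior_pts :: "'v::zf \<Rightarrow> 'v \<Rightarrow> 'v set" where
  "interior_pts \<tau> A = {x. \<exists>U\<in>elts \<tau>. x \<in> elts U \<and> elts U \<subseteq> elts A}"

definition vdense :: "'v::zf \<Rightarrow> 'v set \<Rightarrow> bool" where
  "vdense \<tau> A \<longleftrightarrow> (\<forall>U\<in>elts \<tau>. elts U \<noteq> {} \<longrightarrow> elts U \<inter> A \<noteq> {})"

definition accumulation_point :: "'v::zf \<Rightarrow> 'v \<Rightarrow> 'v \<Rightarrow> 'v \<Rightarrow> bool" where
  "accumulation_point X \<tau> Y x \<longleftrightarrow> x \<in> elts X \<and>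
     (\<forall>U\<in>elts \<tau>. x \<in> elts U \<longrightarrow> elts U \<inter> (elts Y - {x}) \<noteq> {})"

definition vbase :: "'v::zf \<Rightarrow> 'v \<Rightarrow> bool" where
  "vbase \<tau> \<B> \<longleftrightarrow> elts \<B> \<subseteq> elts \<tau> \<and>
     (\<forall>U\<in>elts \<tau>. \<forall>x\<in>elts U. \<exists>V\<in>elts \<B>. x \<in> elts V \<and> elts V \<subseteq> elts U)"

definition discrete_space :: "'v::zf \<Rightarrow> 'v \<Rightarrow> bool" where
  "discrete_space X \<tau> \<longleftrightarrow> elts \<tau> = {U. elts U \<subseteq> elts X}"

definition T1 :: "'v::zf \<Rightarrow> 'v \<Rightarrow> bool" where
  "T1 X \<tau> \<longleftrightarrow> (\<forall>x\<in>elts X. \<forall>y\<in>elts X. x \<noteq> y \<longrightarrow> (\<exists>U\<in>elts \<tau>. x \<in> elts U \<and> y \<notin> elts U))"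

definition first_countable :: "'v::zf \<Rightarrow> 'v \<Rightarrow> bool" where
  "first_countable X \<tau> \<longleftrightarrow> (\<forall>x\<in>elts X. \<exists>\<B>. vcountable \<B> \<and> elts \<B> \<subseteq> elts \<tau> \<and>
     (\<forall>V\<in>elts \<B>. x \<in> elts V) \<and>
     (\<forall>U\<in>elts \<tau>. x \<in> elts U \<longrightarrow> (\<exists>V\<in>elts \<B>. elts V \<subseteq> elts U)))"

definition separable :: "'v::zf \<Rightarrow> 'v \<Rightarrow> bool" where
  "separable X \<tau> \<longleftrightarrow> (\<exists>D. elts D \<subseteq> elts X \<and> vcountable D \<and> vdense \<tau> (elts D))"

definition subspace_topology :: "'v::zf \<Rightarrow> 'v \<Rightarrow> 'v" where
  "subspace_topology \<tau> Y = vset {V. \<exists>U\<in>elts \<tau>. elts V = elts U \<inter> elts Y}"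

text \<open>
  The family of spaces with index set \<open>J\<close> is given by two functions \<open>S\<close>, \<open>T\<close> with domain \<open>J\<close>; the
  \<open>j\<close>-th space has the point set \<open>app S j\<close> and the topology \<open>app T j\<close>. The sum is taken over the
  disjoint copies \<open>{j} \<times> app S j\<close>.
\<close>

definition sum_points :: "'v::zf \<Rightarrow> 'v \<Rightarrow> 'v" where
  "sum_points J S = vset {p. \<exists>j\<in>elts J. \<exists>x\<in>elts (app S j). p = vpair j x}"

definition sum_topology :: "'v::zf \<Rightarrow> 'v \<Rightarrow> 'v \<Rightarrow> 'v" where
  "sum_topology J S T = vset {U. elts U \<subseteq> elts (sum_points J S) \<and>
     (\<forall>j\<in>elts J. vopen (app T j) {x \<in> elts (app S j). vpair j x \<in> elts U})}"

definition one_point_points :: "'v::zf \<Rightarrow> 'v \<Rightarrow> 'v" where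
  "one_point_points X pt = vset (insert pt (elts X))"

definition one_point_topology :: "'v::zf \<Rightarrow> 'v \<Rightarrow> 'v" where
  "one_point_topology X pt = vset ({U. elts U \<subseteq> elts X} \<union>
     {U. \<exists>F. elts F \<subseteq> elts X \<and> vfinite F \<and> elts U = insert pt (elts X) - elts F})"

definition cont_maps :: "'v::zf \<Rightarrow> 'v \<Rightarrow> 'v \<Rightarrow> 'v \<Rightarrow> 'v set" where
  "cont_maps X \<tau> Y \<sigma> =
     {f. vfun f X Y \<and> (\<forall>V\<in>elts \<sigma>. vopen \<tau> {x \<in> elts X. app f x \<in> elts V})}"

definition C :: "'v::zf real_struct \<Rightarrow> 'v \<Rightarrow> 'v \<Rightarrow> 'v set" where
  "C R X \<tau> = cont_maps X \<tau> (rcarrier R) (real_topology R)"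

definition C_disc :: "'v::zf real_struct \<Rightarrow> 'v \<Rightarrow> 'v \<Rightarrow> 'v set" where
  "C_disc R X \<tau> = cont_maps X \<tau> (rcarrier R) (vPow (rcarrier R))"

definition zero_set :: "'v::zf real_struct \<Rightarrow> 'v \<Rightarrow> 'v \<Rightarrow> 'v \<Rightarrow> bool" where
  "zero_set R X \<tau> Z \<longleftrightarrow> (\<exists>f\<in>C R X \<tau>. elts Z = {x \<in> elts X. app f x = rzero R})"

definition cozero_set :: "'v::zf real_struct \<Rightarrow> 'v \<Rightarrow> 'v \<Rightarrow> 'v \<Rightarrow> bool" where
  "cozero_set R X \<tau> U \<longleftrightarrow> (\<exists>Z. zero_set R X \<tau> Z \<and> elts U = elts X - elts Z)"

definition completely_regular :: "'v::zf real_struct \<Rightarrow> 'v \<Rightarrow> 'v \<Rightarrow> bool" where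
  "completely_regular R X \<tau> \<longleftrightarrow> vbase \<tau> (vset {U. cozero_set R X \<tau> U})"

definition tychonoff :: "'v::zf real_struct \<Rightarrow> 'v \<Rightarrow> 'v \<Rightarrow> bool" where
  "tychonoff R X \<tau> \<longleftrightarrow> completely_regular R X \<tau> \<and> T1 X \<tau>"

definition strongly_zero_dimensional :: "'v::zf real_struct \<Rightarrow> 'v \<Rightarrow> 'v \<Rightarrow> bool" where
  "strongly_zero_dimensional R X \<tau> \<longleftrightarrow> completely_regular R X \<tau> \<and>
     (\<forall>Z\<^sub>1 Z\<^sub>2. zero_set R X \<tau> Z\<^sub>1 \<and> zero_set R X \<tau> Z\<^sub>2 \<and> elts Z\<^sub>1 \<inter> elts Z\<^sub>2 = {} \<longrightarrow>
        (\<exists>U. clopen X \<tau> U \<and> elts Z\<^sub>1 \<subseteq> elts U \<and> elts U \<subseteq> elts X - elts Z\<^sub>2))"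

definition is_metric :: "'v::zf real_struct \<Rightarrow> 'v \<Rightarrow> 'v \<Rightarrow> bool" where
  "is_metric R X d \<longleftrightarrow> vfun d (vtimes X X) (rcarrier R) \<and>
     (\<forall>x\<in>elts X. \<forall>y\<in>elts X. rle R (rzero R) (app d (vpair x y)) \<and>
        (app d (vpair x y) = rzero R \<longleftrightarrow> x = y) \<and>
        app d (vpair x y) = app d (vpair y x)) \<and>
     (\<forall>x\<in>elts X. \<forall>y\<in>elts X. \<forall>z\<in>elts X.
        rle R (app d (vpair x z)) (radd R (app d (vpair x y)) (app d (vpair y z))))"

definition metric_topology :: "'v::zf real_struct \<Rightarrow> 'v \<Rightarrow> 'v \<Rightarrow> 'v" where
  "metric_topology R X d = vset {U. elts U \<subseteq> elts X \<and>
     (\<forall>x\<in>elts U. \<exists>r\<in>elts (rcarrier R). rlt R (rzero R) r \<and>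
        {y \<in> elts X. rlt R (app d (vpair x y)) r} \<subseteq> elts U)}"

definition metrizable :: "'v::zf real_struct \<Rightarrow> 'v \<Rightarrow> 'v \<Rightarrow> bool" where
  "metrizable R X \<tau> \<longleftrightarrow> (\<exists>d. is_metric R X d \<and> \<tau> = metric_topology R X d)"

definition G_delta :: "'v::zf \<Rightarrow> 'v \<Rightarrow> bool" where
  "G_delta \<tau> G \<longleftrightarrow> (\<exists>\<U>. vcountable \<U> \<and> elts \<U> \<noteq> {} \<and> elts \<U> \<subseteq> elts \<tau> \<and>
     elts G = (\<Inter>U\<in>elts \<U>. elts U))"

definition c_delta :: "'v::zf \<Rightarrow> 'v \<Rightarrow> 'v \<Rightarrow> bool" where
  "c_delta X \<tau> G \<longleftrightarrow> (\<exists>\<U>. vcountable \<U> \<and> elts \<U> \<noteq> {} \<and> (\<forall>U\<in>elts \<U>. clopen X \<tau> U) \<and>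
     elts G = (\<Inter>U\<in>elts \<U>. elts U))"

definition P_point :: "'v::zf \<Rightarrow> 'v \<Rightarrow> 'v \<Rightarrow> bool" where
  "P_point X \<tau> x \<longleftrightarrow> x \<in> elts X \<and>
     (\<forall>G. G_delta \<tau> G \<and> x \<in> elts G \<longrightarrow> x \<in> interior_pts \<tau> G)"

definition P_space :: "'v::zf \<Rightarrow> 'v \<Rightarrow> bool" where
  "P_space X \<tau> \<longleftrightarrow> is_topology X \<tau> \<and> (\<forall>x\<in>elts X. P_point X \<tau> x)"

definition baire :: "'v::zf \<Rightarrow> bool" where
  "baire \<tau> \<longleftrightarrow> (\<forall>\<U>. denumerable \<U> \<and> (\<forall>U\<in>elts \<U>. U \<in> elts \<tau> \<and> vdense \<tau> (elts U)) \<longrightarrow>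
     vdense \<tau> (\<Inter>U\<in>elts \<U>. elts U))"

definition strongly_baire :: "'v::zf \<Rightarrow> bool" where
  "strongly_baire \<tau> \<longleftrightarrow> (\<forall>\<U>. denumerable \<U> \<and> (\<forall>U\<in>elts \<U>. U \<in> elts \<tau> \<and> vdense \<tau> (elts U)) \<longrightarrow>
     vopen \<tau> (\<Inter>U\<in>elts \<U>. elts U) \<and> vdense \<tau> (\<Inter>U\<in>elts \<U>. elts U))"

definition almost_stable :: "'v::zf \<Rightarrow> bool" where
  "almost_stable \<B> \<longleftrightarrow>
     (\<forall>\<A>. vcountable \<A> \<and> elts \<A> \<noteq> {} \<and> elts \<A> \<subseteq> elts \<B> \<union> {vempty} \<longrightarrow>
        (\<exists>I \<in> elts \<B> \<union> {vempty}. elts I = (\<Inter>A\<in>elts \<A>. elts A)))"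

end

theory Submission imports Defs begin

text \<open>
  In a \<open>P\<close>-space every \<open>G\<^sub>\<delta>\<close>-set is the union of its open subsets, hence open; everything else
  reduces to this without choice, because the families of open sets that arise are canonical:
  the complements of the finite pieces of a cuf set, the largest open sets with a given trace on a
  subspace, the preimages or balls given by a countable null set of positive reals (the iterated
  halves of 1). Conversely, if the power set of the points, or the family of their finite subsets,
  is Dedekind-finite, then a countable family of open (respectively, cofinite) sets is finite.

  Inside the model, sets can only be formed by separation for first-order formulas with
  parameters. The predicates of HOL that are given by such formulas are closed under the logical
  operations and under substitution of definable terms, so that definability is a routine side
  condition.
\<close>

subsection \<open>Definability with parameters\<close>

text \<open>The obstacle is that HOL and the model disagree about infinity. The \<open>omega\<close>
  of the model may be nonstandard, a \<open>vfinite\<close> set may be infinite in HOL, and a HOL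
  set of elements need not be the extension of an element. So no HOL induction, recursion or
  cardinality theorem transfers: induction on numbers and on finite sets is proved inside the model
  and carries a definability premise, and a comprehension must be shown to be an extension before
  \<open>elts (vset ...)\<close> can be simplified. Choice in HOL does no harm as long as it only
  names what a definable relation already determines. Two facts then carry the topology. A countable
  family can be pushed through a definable set-valued map (\<open>countable_family\<close>), which
  makes the P-space property applicable; and an infinite countable subset makes a set
  Dedekind-infinite (\<open>dedekind_infiniteI\<close>), which produces P-spaces from finiteness
  conditions.\<close>

primrec ren :: "(nat \<Rightarrow> nat) \<Rightarrow> fm \<Rightarrow> fm" where
  "ren r (Mem i j) = Mem (r i) (r j)"
| "ren r (Eq i j) = Eq (r i) (r j)"
| "ren r (Neg p) = Neg (ren r p)"
| "ren r (Conj p q) = Conj (ren r p) (ren r q)"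
| "ren r (Ex p) = Ex (ren (case_nat 0 (\<lambda>n. Suc (r n))) p)"

lemma sat_ren: "sat el (ren r p) e \<longleftrightarrow> sat el p (\<lambda>n. e (r n))"
proof (induction p arbitrary: r e)
  case (Ex p)
  have "(\<lambda>n. case_nat x e (case_nat 0 (\<lambda>n. Suc (r n)) n)) = case_nat x (\<lambda>n. e (r n))" for x
    by (auto split: nat.split)
  then show ?case by (simp add: Ex)
qed auto

definition env :: "(nat \<Rightarrow> nat + 'v) \<Rightarrow> (nat \<Rightarrow> 'v) \<Rightarrow> nat \<Rightarrow> 'v" where
  "env r e n = (case r n of Inl i \<Rightarrow> e i | Inr c \<Rightarrow> c)"

text \<open>The assignment \<open>r\<close> says of every index of the formula whether it is one of the variables or
  a parameter, so that parameters need not be threaded through the environment.\<close>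

definition definable :: "((nat \<Rightarrow> 'v::zf) \<Rightarrow> bool) \<Rightarrow> bool" where
  "definable Q \<longleftrightarrow> (\<exists>p r. \<forall>e. Q e \<longleftrightarrow> sat elts p (env r e))"

text \<open>The language has no function symbols, so a term counts as definable when its graph is;
  index 0 holds the value.\<close>

definition definable_term :: "((nat \<Rightarrow> 'v::zf) \<Rightarrow> 'v) \<Rightarrow> bool" where
  "definable_term t \<longleftrightarrow> definable (\<lambda>e. e 0 = t (\<lambda>n. e (Suc n)))"

lemma definable_rename:
  assumes "definable Q" shows "definable (\<lambda>e. Q (\<lambda>n. e (f n)))"
proof -
  obtain p r where Q: "\<And>e. Q e \<longleftrightarrow> sat elts p (env r e)"
    using assms unfolding definable_def by blast
  have "env r (\<lambda>n. e (f n)) = env (\<lambda>n. map_sum f id (r n)) e" for e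
    by (auto simp: env_def split: sum.split)
  then show ?thesis unfolding definable_def using Q by metis
qed

lemma definable_Not:
  assumes "definable Q" shows "definable (\<lambda>e. \<not> Q e)"
  using assms unfolding definable_def by (metis sat.simps(3))

lemma definable_conj:
  assumes "definable Q" "definable Q'" shows "definable (\<lambda>e. Q e \<and> Q' e)"
proof -
  obtain p r where Q: "\<And>e. Q e \<longleftrightarrow> sat elts p (env r e)"
    using assms unfolding definable_def by blast
  obtain p' r' where Q': "\<And>e. Q' e \<longleftrightarrow> sat elts p' (env r' e)"
    using assms unfolding definable_def by blast
  \<comment> \<open>The two formulas may use one index for different things, so \<open>p\<close> is
    moved to the even and \<open>p'\<close> to the odd indices, and a single assignment interleaves
    \<open>r\<close> and \<open>r'\<close>.\<close>
  let ?r = "\<lambda>n. if even n then r (n div 2) else r' (n div 2)"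
  have "env r e = (\<lambda>n. env ?r e (2 * n))" "env r' e = (\<lambda>n. env ?r e (Suc (2 * n)))" for e
    by (auto simp: env_def)
  then have "\<forall>e. (Q e \<and> Q' e) \<longleftrightarrow>
      sat elts (Conj (ren (\<lambda>n. 2 * n) p) (ren (\<lambda>n. Suc (2 * n)) p')) (env ?r e)"
    by (simp only: sat_ren sat.simps Q Q' simp_thms)
  then show ?thesis unfolding definable_def by (intro exI)
qed

lemma definable_ex:
  assumes "definable (\<lambda>e. Q (e 0) (\<lambda>n. e (Suc n)))" shows "definable (\<lambda>e. \<exists>x. Q x e)"
proof -
  obtain p r where Q: "\<And>e. Q (e 0) (\<lambda>n. e (Suc n)) \<longleftrightarrow> sat elts p (env r e)"
    using assms unfolding definable_def by blast
  \<comment> \<open>The assignment may send many indices to variable 0. \<open>?f\<close> merges all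
    of them into the index that \<open>Ex\<close> binds and shifts the others up; \<open>?r\<close>
    lowers the remaining variables by one. Its value \<open>i - Suc 0\<close> at
    \<open>i = 0\<close> is never read.\<close>
  let ?f = "\<lambda>n. if r n = Inl 0 then 0 else Suc n"
  let ?r = "\<lambda>n. map_sum (\<lambda>i. i - Suc 0) id (r n)"
  have "env r (case_nat x e) = (\<lambda>n. case_nat x (env ?r e) (?f n))" for x e
    by (auto simp: env_def fun_eq_iff split: sum.split nat.split)
  then have "Q x e \<longleftrightarrow> sat elts (ren ?f p) (case_nat x (env ?r e))" for x e
    using Q[of "case_nat x e"] by (simp only: sat_ren nat.case)
  then have "\<forall>e. (\<exists>x. Q x e) \<longleftrightarrow> sat elts (Ex (ren ?f p)) (env ?r e)" by simp
  then show ?thesis unfolding definable_def by (intro exI)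
qed

lemma definable_base:
  "definable (\<lambda>e. e i \<in> elts (e j))" "definable (\<lambda>e. e i = e j)" "definable (\<lambda>e. e i = c)"
proof -
  show "definable (\<lambda>e. e i \<in> elts (e j))"
    unfolding definable_def by (intro exI[of _ "Mem i j"] exI[of _ Inl]) (simp add: env_def)
  show "definable (\<lambda>e. e i = e j)"
    unfolding definable_def by (intro exI[of _ "Eq i j"] exI[of _ Inl]) (simp add: env_def)
  show "definable (\<lambda>e. e i = c)"
    unfolding definable_def
    by (intro exI[of _ "Eq 0 1"] exI[of _ "case_nat (Inl i) (\<lambda>_. Inr c)"]) (simp add: env_def)
qed

named_theorems definable_intros

lemma definable_term_var [definable_intros]: "definable_term (\<lambda>e. e i)"
  unfolding definable_term_def by (rule definable_base)

lemma definable_term_const [definable_intros]: "definable_term (\<lambda>e. c)"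
  unfolding definable_term_def by (rule definable_base)

text \<open>Formulas contain no terms, so \<open>t e\<close> is introduced by an existential
  quantifier over its graph.\<close>

lemma definable_subst:
  assumes "definable_term t" and "definable (\<lambda>e. Q (e 0) (\<lambda>n. e (Suc n)))"
  shows "definable (\<lambda>e. Q (t e) e)"
proof -
  have "definable (\<lambda>e. \<exists>x. x = t e \<and> Q x e)"
    using assms unfolding definable_term_def by (intro definable_ex definable_conj)
  then show ?thesis by simp
qed

lemma definable_rename_term:
  "definable_term t \<Longrightarrow> definable_term (\<lambda>e. t (\<lambda>n. e (f n)))"
  unfolding definable_term_def
  using definable_rename[of "\<lambda>e. e 0 = t (\<lambda>n. e (Suc n))" "case_nat 0 (\<lambda>n. Suc (f n))"] by simp

lemma definable_mem [definable_intros]: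
  assumes "definable_term t" "definable_term s" shows "definable (\<lambda>e. t e \<in> elts (s e))"
  by (rule definable_subst[OF assms(1)], rule definable_subst[OF definable_rename_term[OF assms(2)]],
      rule definable_base)

lemma definable_eq [definable_intros]:
  assumes "definable_term t" "definable_term s" shows "definable (\<lambda>e. t e = s e)"
  by (rule definable_subst[OF assms(1)], rule definable_subst[OF definable_rename_term[OF assms(2)]],
      rule definable_base)

lemma definable_const [definable_intros]: "definable (\<lambda>e. c)"
proof (cases c)
  case True
  show ?thesis using definable_base(2)[of 0 0] True by simp
next
  case False
  show ?thesis using definable_Not[OF definable_base(2)[of 0 0]] False by simp
qed

lemmas [definable_intros] = definable_Not definable_conj definable_ex

lemma definable_disj [definable_intros]:
  assumes "definable Q" "definable Q'" shows "definable (\<lambda>e. Q e \<or> Q' e)"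
proof -
  have "definable (\<lambda>e. \<not> (\<not> Q e \<and> \<not> Q' e))" by (intro definable_intros assms)
  then show ?thesis by simp
qed

lemma definable_imp [definable_intros]:
  assumes "definable Q" "definable Q'" shows "definable (\<lambda>e. Q e \<longrightarrow> Q' e)"
proof -
  have "definable (\<lambda>e. \<not> Q e \<or> Q' e)" by (intro definable_intros assms)
  then show ?thesis by simp
qed

lemma definable_iff [definable_intros]:
  assumes "definable Q" "definable Q'" shows "definable (\<lambda>e. Q e \<longleftrightarrow> Q' e)"
proof -
  have "definable (\<lambda>e. (Q e \<longrightarrow> Q' e) \<and> (Q' e \<longrightarrow> Q e))" by (intro definable_intros assms)
  then show ?thesis by (simp only: iff_conv_conj_imp)
qed

lemma definable_all [definable_intros]:
  assumes "definable (\<lambda>e. Q (e 0) (\<lambda>n. e (Suc n)))" shows "definable (\<lambda>e. \<forall>x. Q x e)"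
proof -
  have "definable (\<lambda>e. \<not> (\<exists>x. \<not> Q x e))" by (intro definable_intros assms)
  then show ?thesis by simp
qed

lemma definable_bex [definable_intros]:
  assumes "definable_term t" "definable (\<lambda>e. Q (e 0) (\<lambda>n. e (Suc n)))"
  shows "definable (\<lambda>e. \<exists>x\<in>elts (t e). Q x e)"
  unfolding Bex_def by (intro definable_intros assms definable_rename_term[OF assms(1)])

lemma definable_ball [definable_intros]:
  assumes "definable_term t" "definable (\<lambda>e. Q (e 0) (\<lambda>n. e (Suc n)))"
  shows "definable (\<lambda>e. \<forall>x\<in>elts (t e). Q x e)"
  unfolding Ball_def by (intro definable_intros assms definable_rename_term[OF assms(1)])

lemma definable_subset [definable_intros]:
  assumes "definable_term t" "definable_term s" shows "definable (\<lambda>e. elts (t e) \<subseteq> elts (s e))"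
  unfolding subset_iff by (intro definable_intros assms assms[THEN definable_rename_term])

text \<open>The second premise bounds the comprehension by an element \<open>x\<close>, which is
  what separation requires.\<close>

lemma vset_separation:
  assumes "definable (\<lambda>e. P (e 0))" and "\<And>z. P z \<Longrightarrow> z \<in> elts x"
  shows "elts (vset {z. P z}) = {z. P z}"
proof -
  obtain p r where P: "\<forall>e. P (e 0) \<longleftrightarrow> sat elts p (env r e)"
    using assms(1) unfolding definable_def by (elim exE)
  \<comment> \<open>\<open>P\<close> only looks at \<open>e 0\<close>, so the environment with
    constant value \<open>z\<close> will do: all variables merge into index 0, and the parameter at
    \<open>n\<close> moves to \<open>Suc n\<close>. \<open>projr\<close> is junk where
    \<open>r n\<close> is a variable, but \<open>f\<close> never points there.\<close>
  define f where "f n = (case r n of Inl _ \<Rightarrow> 0 | Inr _ \<Rightarrow> Suc n)" for n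
  have "env r (\<lambda>_. z) = (\<lambda>n. case_nat z (\<lambda>n. projr (r n)) (f n))" for z
    by (rule ext) (simp add: env_def f_def split: sum.split)
  then have "P z \<longleftrightarrow> sat elts (ren f p) (case_nat z (\<lambda>n. projr (r n)))" for z
    using P[THEN spec, of "\<lambda>_. z"] by (simp only: sat_ren)
  then have "\<exists>y. elts y = {z \<in> elts x. P z}"
    using separation[of x "ren f p" "\<lambda>n. projr (r n)"] by (simp only:)
  moreover have "{z \<in> elts x. P z} = {z. P z}" using assms(2) by blast
  ultimately show ?thesis using elts_vset by metis
qed

subsection \<open>Pairs, products and functions\<close>

lemma elts_vset_pair [simp]: "elts (vset {x, y}) = {x, y}"
  by (rule exE[OF pairing]) (rule elts_vset)

lemma elts_vset_single [simp]: "elts (vset {x}) = {x}"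
  using elts_vset_pair[of x x] by simp

lemma elts_vset_Union: "elts (vset (\<Union>y\<in>elts x. elts y)) = (\<Union>y\<in>elts x. elts y)"
  by (rule exE[OF union]) (rule elts_vset)

lemma elts_vset_Un [simp]: "elts (vset (elts x \<union> elts y)) = elts x \<union> elts y"
  using elts_vset_Union[of "vset {x, y}"] by simp

lemma elts_vset_insert [simp]: "elts (vset (insert a (elts x))) = insert a (elts x)"
  using elts_vset_Un[of "vset {a}" x] by simp

lemma elts_vset_Diff [simp]: "elts (vset (elts x - elts y)) = elts x - elts y"
  unfolding set_diff_eq by (intro vset_separation[of _ x] definable_intros) simp

lemma elts_vset_Int [simp]: "elts (vset (elts x \<inter> elts y)) = elts x \<inter> elts y"
  unfolding Int_def by (intro vset_separation[of _ x] definable_intros) simp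

lemma vset_elts [simp]: "vset (elts x) = x"
  by (simp add: elts_vset extensionality)

lemma elts_vempty [simp]: "elts vempty = {}"
  using elts_vset_Diff[of undefined undefined] by (simp add: vempty_def)

lemma elts_vPow [simp]: "elts (vPow A) = {B. elts B \<subseteq> elts A}"
  unfolding vPow_def by (rule exE[OF power_set]) (rule elts_vset)

text \<open>The second premise says that the comprehension is an extension. Only then does the
  description in \<open>vset\<close> denote, and the graph becomes the formula that \<open>x\<close>
  has exactly these members.\<close>

lemma definable_term_vset [definable_intros]:
  assumes "definable (\<lambda>e. Q (e 0) (\<lambda>n. e (Suc n)))" and "\<And>e. elts (vset {z. Q z e}) = {z. Q z e}"
  shows "definable_term (\<lambda>e. vset {z. Q z e})"
proof -
  have "x = vset {z. Q z e} \<longleftrightarrow> elts x = {z. Q z e}" for x e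
    by (metis assms(2) vset_elts)
  then have "x = vset {z. Q z e} \<longleftrightarrow> (\<forall>z. z \<in> elts x \<longleftrightarrow> Q z e)" for x e
    by (simp only: set_eq_iff mem_Collect_eq)
  then have "(\<lambda>e. e 0 = vset {z. Q z (\<lambda>n. e (Suc n))}) = (\<lambda>e. \<forall>z. z \<in> elts (e 0) \<longleftrightarrow> Q z (\<lambda>n. e (Suc n)))"
    by (simp only:)
  moreover have "definable (\<lambda>e. \<forall>z. z \<in> elts (e 0) \<longleftrightarrow> Q z (\<lambda>n. e (Suc n)))"
    using definable_rename[OF assms(1), of "case_nat 0 (\<lambda>n. Suc (Suc n))"]
    by (intro definable_intros) simp
  ultimately show ?thesis unfolding definable_term_def by (simp only:)
qed

lemma definable_term_vpair [definable_intros]: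
  assumes "definable_term t" "definable_term s" shows "definable_term (\<lambda>e. vpair (t e) (s e))"
proof -
  have pair: "definable_term (\<lambda>e. vset {t e, s e})"
    if "definable_term t" "definable_term s" for t s :: "(nat \<Rightarrow> 'a) \<Rightarrow> 'a"
  proof -
    have eq: "{t e, s e} = {z. z = t e \<or> z = s e}" for e by blast
    show ?thesis unfolding eq
    proof (rule definable_term_vset)
      show "definable (\<lambda>e. e 0 = t (\<lambda>n. e (Suc n)) \<or> e 0 = s (\<lambda>n. e (Suc n)))"
        by (intro definable_intros that[THEN definable_rename_term])
      show "elts (vset {z. z = t e \<or> z = s e}) = {z. z = t e \<or> z = s e}" for e
        unfolding eq[symmetric] by simp
    qed
  qed
  have "definable_term (\<lambda>e. vset {t e})" using pair[OF assms(1) assms(1)] by simp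
  then show ?thesis unfolding vpair_def using pair[OF assms] by (rule pair)
qed

lemma vpair_eq [simp]: "vpair x y = vpair x' y' \<longleftrightarrow> x = x' \<and> y = y'"
proof
  assume "vpair x y = vpair x' y'"
  then have "elts ` elts (vpair x y) = elts ` elts (vpair x' y')" by simp
  then have "{{x}, {x, y}} = {{x'}, {x', y'}}" by (simp add: vpair_def)
  then show "x = x' \<and> y = y'" by (auto simp: doubleton_eq_iff)
qed auto

lemma elts_vtimes: "elts (vtimes A B) = {p. \<exists>x\<in>elts A. \<exists>y\<in>elts B. p = vpair x y}"
  unfolding vtimes_def
proof (rule vset_separation)
  fix z assume "\<exists>x\<in>elts A. \<exists>y\<in>elts B. z = vpair x y"
  then show "z \<in> elts (vPow (vPow (vset (elts A \<union> elts B))))" by (auto simp: vpair_def)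
qed (intro definable_intros)

lemma vpair_vtimes [simp]: "vpair x y \<in> elts (vtimes A B) \<longleftrightarrow> x \<in> elts A \<and> y \<in> elts B"
  by (auto simp: elts_vtimes)

lemma relation_exists:
  assumes "definable (\<lambda>e. R (e 0) (e (Suc 0)))"
  obtains f where "elts f \<subseteq> elts (vtimes A B)"
    "\<And>x y. vpair x y \<in> elts f \<longleftrightarrow> x \<in> elts A \<and> y \<in> elts B \<and> R x y"
proof -
  let ?P = "\<lambda>p. \<exists>x\<in>elts A. \<exists>y\<in>elts B. p = vpair x y \<and> R x y"
  \<comment> \<open>The arguments are swapped because the inner quantifier, over \<open>y\<close>,
    binds index 0.\<close>
  have R: "definable (\<lambda>e. R (e (Suc 0)) (e 0))"
    using definable_rename[OF assms, of "\<lambda>n. if n = 0 then Suc 0 else 0"] by simp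
  have "definable (\<lambda>e. ?P (e 0))" by (intro definable_intros R)
  then have f: "elts (vset {p. ?P p}) = {p. ?P p}"
    by (rule vset_separation[where x = "vtimes A B"]) auto
  show ?thesis by (rule that[of "vset {p. ?P p}"]) (auto simp: f)
qed

lemma vpair_app_iff:
  assumes "vfun f A B"
  shows "vpair x y \<in> elts f \<longleftrightarrow> x \<in> elts A \<and> y = app f x"
proof -
  have "x \<in> elts A" if "vpair x y \<in> elts f" for y
    using assms that vpair_vtimes unfolding vfun_def by blast
  moreover have "vpair x y \<in> elts f \<longleftrightarrow> y = app f x" if "x \<in> elts A"
  proof -
    have "\<exists>!y. vpair x y \<in> elts f" using assms that unfolding vfun_def by blast
    then obtain z where z: "\<And>y. vpair x y \<in> elts f \<longleftrightarrow> y = z" by (auto simp: Ex1_def)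
    then show ?thesis unfolding app_def by simp
  qed
  ultimately show ?thesis by blast
qed

lemma app_in: "vfun f A B \<Longrightarrow> x \<in> elts A \<Longrightarrow> app f x \<in> elts B"
  using vpair_app_iff[of f A B x "app f x"] vpair_vtimes unfolding vfun_def by blast

text \<open>\<open>h\<close> may be any HOL function, even one given by cases or by
  \<open>SOME\<close>. Only its graph enters the model, and between \<open>A\<close> and
  \<open>B\<close> that graph has to agree with a definable relation.\<close>

lemma vfun_exists:
  assumes "definable (\<lambda>e. R (e 0) (e (Suc 0)))"
    and h: "\<And>x. x \<in> elts A \<Longrightarrow> h x \<in> elts B"
    and R: "\<And>x y. x \<in> elts A \<Longrightarrow> y \<in> elts B \<Longrightarrow> R x y \<longleftrightarrow> y = h x"
  obtains f where "vfun f A B" "\<And>x. x \<in> elts A \<Longrightarrow> app f x = h x"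
proof -
  obtain f where f: "elts f \<subseteq> elts (vtimes A B)"
    "\<And>x y. vpair x y \<in> elts f \<longleftrightarrow> x \<in> elts A \<and> y \<in> elts B \<and> R x y"
    using relation_exists[OF assms(1), of A B] by blast
  have iff: "vpair x y \<in> elts f \<longleftrightarrow> y = h x" if "x \<in> elts A" for x y
    using f(2)[of x y] R[OF that] h[OF that] that by blast
  have f': "vfun f A B" unfolding vfun_def using f(1) iff by simp
  have "app f x = h x" if "x \<in> elts A" for x
    using vpair_app_iff[OF f', of x "h x"] iff[OF that] by simp
  then show ?thesis using that f' by simp
qed

section \<open>Equipotence as a first-order relation\<close>

text \<open>A form of equipotence that avoids the description operator in \<open>app\<close>. The
  witness may contain pairs outside \<open>A\<close> and \<open>B\<close>; they are ignored here,
  and a proof that uses \<open>f\<close> elsewhere has to restrict it.\<close>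

definition bij_rel :: "'v::zf \<Rightarrow> 'v \<Rightarrow> 'v \<Rightarrow> bool" where
  "bij_rel f A B \<longleftrightarrow> (\<forall>x\<in>elts A. \<exists>y\<in>elts B. vpair x y \<in> elts f) \<and>
     (\<forall>y\<in>elts B. \<exists>x\<in>elts A. vpair x y \<in> elts f) \<and>
     (\<forall>x\<in>elts A. \<forall>y\<in>elts B. \<forall>x'\<in>elts A. \<forall>y'\<in>elts B.
        vpair x y \<in> elts f \<longrightarrow> vpair x' y' \<in> elts f \<longrightarrow> (x = x' \<longleftrightarrow> y = y'))"

lemma equipotentI:
  assumes "definable (\<lambda>e. R (e 0) (e (Suc 0)))"
    and "\<And>x. x \<in> elts A \<Longrightarrow> \<exists>y\<in>elts B. R x y"
    and "\<And>y. y \<in> elts B \<Longrightarrow> \<exists>x\<in>elts A. R x y"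
    and "\<And>x y x' y'. \<lbrakk>x \<in> elts A; y \<in> elts B; x' \<in> elts A; y' \<in> elts B; R x y; R x' y'\<rbrakk> \<Longrightarrow> x = x' \<longleftrightarrow> y = y'"
  shows "equipotent A B"
proof -
  \<comment> \<open>The choice is only apparent: by the last premise, \<open>R\<close> relates
    \<open>x\<close> to a single element of \<open>B\<close>.\<close>
  define h where "h x = (SOME y. y \<in> elts B \<and> R x y)" for x
  have h: "h x \<in> elts B \<and> R x (h x)" if "x \<in> elts A" for x
    using someI_ex[of "\<lambda>y. y \<in> elts B \<and> R x y"] assms(2)[OF that] unfolding h_def by blast
  obtain f where f: "vfun f A B" "\<And>x. x \<in> elts A \<Longrightarrow> app f x = h x"
  proof (rule vfun_exists[OF assms(1), of A h B])
    show "R x y \<longleftrightarrow> y = h x" if "x \<in> elts A" "y \<in> elts B" for x y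
      using assms(4)[of x y x "h x"] h[of x] that by blast
  qed (use h in auto)
  have "inj_on h (elts A)"
    by (rule inj_onI) (metis assms(4) h)
  moreover have "y \<in> h ` elts A" if y: "y \<in> elts B" for y
  proof -
    obtain x where "x \<in> elts A" "R x y" using assms(3)[OF y] by blast
    then have "y = h x" using assms(4)[of x y x "h x"] h[of x] y by blast
    then show ?thesis using \<open>x \<in> elts A\<close> by blast
  qed
  ultimately have "bij_betw h (elts A) (elts B)"
    unfolding bij_betw_def using h by blast
  then have "bij_betw (app f) (elts A) (elts B)"
    using f(2) by (simp cong: bij_betw_cong)
  then show ?thesis unfolding equipotent_def using f(1) by blast
qed

lemma equipotent_iff: "equipotent A B \<longleftrightarrow> (\<exists>f. bij_rel f A B)"
proof
  assume "equipotent A B"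
  then obtain f where f: "vfun f A B" "bij_betw (app f) (elts A) (elts B)"
    unfolding equipotent_def by blast
  have inj: "x = x'" if "x \<in> elts A" "x' \<in> elts A" "app f x = app f x'" for x x'
    using f(2) that unfolding bij_betw_def inj_on_def by blast
  have surj: "\<exists>x\<in>elts A. y = app f x" if "y \<in> elts B" for y
    using f(2) that unfolding bij_betw_def by blast
  have "bij_rel f A B"
    unfolding bij_rel_def vpair_app_iff[OF f(1)]
    using app_in[OF f(1)] inj surj by simp blast
  then show "\<exists>f. bij_rel f A B" ..
next
  assume "\<exists>f. bij_rel f A B"
  then obtain f where f: "bij_rel f A B" ..
  show "equipotent A B"
  proof (rule equipotentI[of "\<lambda>x y. vpair x y \<in> elts f"])
    show "definable (\<lambda>e. vpair (e 0) (e (Suc 0)) \<in> elts f)" by (intro definable_intros)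
  qed (use f in \<open>unfold bij_rel_def, blast+\<close>)
qed

lemma definable_equipotent [definable_intros]:
  assumes "definable_term t" "definable_term s" shows "definable (\<lambda>e. equipotent (t e) (s e))"
  unfolding equipotent_iff bij_rel_def by (intro definable_intros assms assms[THEN definable_rename_term])

lemma equipotent_refl: "equipotent A A"
proof (rule equipotentI[of "(=)"])
  show "definable (\<lambda>e. e 0 = e (Suc 0))" by (intro definable_intros)
qed auto

lemma equipotent_sym:
  assumes "equipotent A B" shows "equipotent B A"
proof -
  obtain f where f: "bij_rel f A B" using assms unfolding equipotent_iff by blast
  show ?thesis
  proof (rule equipotentI[of "\<lambda>x y. vpair y x \<in> elts f"])
    show "definable (\<lambda>e. vpair (e (Suc 0)) (e 0) \<in> elts f)" by (intro definable_intros)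
  qed (use f in \<open>unfold bij_rel_def, blast+\<close>)
qed

lemma equipotent_trans:
  assumes "equipotent A B" "equipotent B D" shows "equipotent A D"
proof -
  obtain f g where fg: "bij_rel f A B" "bij_rel g B D" using assms unfolding equipotent_iff by blast
  show ?thesis
  proof (rule equipotentI[of "\<lambda>x z. \<exists>y\<in>elts B. vpair x y \<in> elts f \<and> vpair y z \<in> elts g"])
    show "definable (\<lambda>e. \<exists>y\<in>elts B. vpair (e 0) y \<in> elts f \<and> vpair y (e (Suc 0)) \<in> elts g)"
      by (intro definable_intros)
  qed (use fg in \<open>unfold bij_rel_def, metis+\<close>)
qed

text \<open>Definability of a relation is stated for the variables 0 and 1. This carries it to
  arbitrary terms, which is how relations defined within a proof join the automatic rules.\<close>

lemma definable_app2:
  assumes "definable (\<lambda>e. R (e 0) (e (Suc 0)))" and "definable_term t" "definable_term s"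
  shows "definable (\<lambda>e. R (t e) (s e))"
proof (rule definable_subst[OF assms(2), where Q = "\<lambda>x e. R x (s e)"],
    rule definable_subst[OF definable_rename_term[OF assms(3)], where Q = "\<lambda>y e. R (e 0) y"])
  show "definable (\<lambda>e. R (e (Suc 0)) (e 0))"
    using definable_rename[OF assms(1), of "\<lambda>n. if n = 0 then Suc 0 else 0"] by simp
qed

text \<open>Outside the domain of \<open>f\<close>, the junk value of \<open>app f\<close> does not depend on the argument.\<close>

lemma definable_term_app:
  assumes "vfun f A B" "definable_term t"
  shows "definable_term (\<lambda>e. app f (t e))"
proof -
  have "app f x = (THE y. False)" if "x \<notin> elts A" for x
    using vpair_app_iff[OF assms(1), of x] that unfolding app_def by simp
  then have "y = app f x \<longleftrightarrow> vpair x y \<in> elts f \<or> x \<notin> elts A \<and> y = (THE y. False)" for x y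
    using vpair_app_iff[OF assms(1)] by auto
  then show ?thesis unfolding definable_term_def
    by (simp only:) (intro definable_intros definable_rename_term[OF assms(2)])
qed

lemma elts_vset_remove [simp]: "elts (vset (elts x - {a})) = elts x - {a}"
  using elts_vset_Diff[of x "vset {a}"] by simp

lemma elts_eq_iff: "elts x = elts y \<longleftrightarrow> x = y"
  using extensionality by blast

lemma elts_eq_empty_iff [simp]: "elts x = {} \<longleftrightarrow> x = vempty"
  using elts_eq_iff[of x vempty] by simp

subsection \<open>Natural numbers\<close>

definition vsucc :: "'v::zf \<Rightarrow> 'v" where
  "vsucc n = vset (insert n (elts n))"

lemma elts_vsucc [simp]: "elts (vsucc n) = insert n (elts n)"
  by (simp add: vsucc_def)

lemma definable_term_vsucc [definable_intros]:
  assumes "definable_term t" shows "definable_term (\<lambda>e. vsucc (t e))"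
proof -
  have eq: "insert (t e) (elts (t e)) = {z. z = t e \<or> z \<in> elts (t e)}" for e by blast
  show ?thesis unfolding vsucc_def eq
  proof (rule definable_term_vset)
    show "definable (\<lambda>e. e 0 = t (\<lambda>n. e (Suc n)) \<or> e 0 \<in> elts (t (\<lambda>n. e (Suc n))))"
      by (intro definable_intros assms[THEN definable_rename_term])
    show "elts (vset {z. z = t e \<or> z \<in> elts (t e)}) = {z. z = t e \<or> z \<in> elts (t e)}" for e
      unfolding eq[symmetric] by simp
  qed
qed

lemma vinductive_iff: "vinductive w \<longleftrightarrow> vempty \<in> elts w \<and> (\<forall>x\<in>elts w. vsucc x \<in> elts w)"
  unfolding vinductive_def elts_vsucc[symmetric] elts_eq_iff by simp

lemma elts_omega: "elts (omega :: 'v::zf) = {n. \<forall>w. vinductive w \<longrightarrow> n \<in> elts w}"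
proof -
  obtain w :: 'v where w: "vinductive w" using infinity unfolding vinductive_def by blast
  show ?thesis unfolding omega_def
  proof (rule vset_separation[of _ w])
    show "definable (\<lambda>e. \<forall>w. vinductive w \<longrightarrow> e 0 \<in> elts w)"
      unfolding vinductive_iff by (intro definable_intros)
  qed (use w in blast)
qed

lemma vempty_omega [simp]: "vempty \<in> elts omega"
  and vsucc_omega [simp]: "n \<in> elts omega \<Longrightarrow> vsucc n \<in> elts omega"
  by (auto simp: elts_omega vinductive_iff)

lemma omega_induct [consumes 1, case_names definable zero succ]:
  assumes "n \<in> elts omega" and P: "definable (\<lambda>e. P (e 0))" and "P vempty"
    and "\<And>n. n \<in> elts omega \<Longrightarrow> P n \<Longrightarrow> P (vsucc n)"
  shows "P n"
proof -
  let ?w = "vset {n. n \<in> elts omega \<and> P n}"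
  have w: "elts ?w = {n. n \<in> elts omega \<and> P n}"
  proof (rule vset_separation[of _ omega])
    show "definable (\<lambda>e. e 0 \<in> elts omega \<and> P (e 0))" by (intro definable_intros P)
  qed simp
  have "vinductive ?w" unfolding vinductive_iff w using assms(3,4) by simp
  then have "n \<in> elts ?w" using assms(1) by (simp add: elts_omega)
  then show ?thesis by (simp add: w)
qed

lemma mem_irrefl: "x \<notin> elts x"
  using foundation[of "vset {x}"] by auto

lemma omega_mem:
  assumes "n \<in> elts omega" "m \<in> elts n" shows "m \<in> elts omega"
proof -
  have "\<forall>m\<in>elts n. m \<in> elts omega"
    using assms(1)
  proof (induction rule: omega_induct)
    case definable show ?case by (intro definable_intros)
  qed auto
  then show ?thesis using assms(2) by blast
qed

lemma omega_trans:
  assumes "n \<in> elts omega" "m \<in> elts n" "k \<in> elts m" shows "k \<in> elts n"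
proof -
  have "\<forall>m\<in>elts n. \<forall>k\<in>elts m. k \<in> elts n"
    using assms(1)
  proof (induction rule: omega_induct)
    case definable show ?case by (intro definable_intros)
  qed auto
  then show ?thesis using assms(2,3) by blast
qed

lemma omega_asym: "n \<in> elts omega \<Longrightarrow> m \<in> elts n \<Longrightarrow> n \<notin> elts m"
  using omega_trans[of n m n] mem_irrefl[of n] by blast

lemma vsucc_le:
  assumes "n \<in> elts omega" "m \<in> elts n" shows "vsucc m \<in> elts (vsucc n)"
proof -
  have "\<forall>m\<in>elts n. vsucc m \<in> elts (vsucc n)"
    using assms(1)
  proof (induction rule: omega_induct)
    case definable show ?case by (intro definable_intros)
  qed auto
  then show ?thesis using assms(2) by blast
qed

lemma vempty_mem_or_eq:
  assumes "n \<in> elts omega" shows "vempty \<in> elts n \<or> n = vempty"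
  using assms
proof (induction rule: omega_induct)
  case definable show ?case by (intro definable_intros)
qed auto

lemma omega_linear:
  assumes "m \<in> elts omega" "n \<in> elts omega"
  shows "m \<in> elts n \<or> m = n \<or> n \<in> elts m"
proof -
  have "\<forall>n\<in>elts omega. m \<in> elts n \<or> m = n \<or> n \<in> elts m"
    using assms(1)
  proof (induction rule: omega_induct)
    case definable show ?case by (intro definable_intros)
  next
    case zero show ?case using vempty_mem_or_eq by blast
  next
    case (succ m)
    then show ?case using vsucc_le[of _ m] by fastforce
  qed
  then show ?thesis using assms(2) by blast
qed

text \<open>Foundation supplies a membership-minimal element, and membership is the order of
  \<open>omega\<close>.\<close>

lemma omega_least:
  assumes "definable (\<lambda>e. P (e 0))" "n \<in> elts omega" "P n"
  obtains m where "m \<in> elts omega" "P m" "\<And>k. k \<in> elts m \<Longrightarrow> \<not> P k"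
proof -
  let ?S = "vset {n. n \<in> elts omega \<and> P n}"
  have S: "elts ?S = {n. n \<in> elts omega \<and> P n}"
  proof (rule vset_separation[of _ omega])
    show "definable (\<lambda>e. e 0 \<in> elts omega \<and> P (e 0))" by (intro definable_intros assms)
  qed simp
  have "elts ?S \<noteq> {}" unfolding S using assms(2,3) by blast
  then obtain m where m: "m \<in> elts ?S" "elts m \<inter> elts ?S = {}" using foundation by blast
  then have m': "m \<in> elts omega" "P m" unfolding S by blast+
  have "\<not> P k" if "k \<in> elts m" for k
    using m(2) that omega_mem[OF m'(1) that] unfolding S by blast
  then show ?thesis using m' that by blast
qed

subsection \<open>Finite sets\<close>

lemma definable_vfinite [definable_intros]:
  assumes "definable_term t" shows "definable (\<lambda>e. vfinite (t e))"
  unfolding vfinite_def by (intro definable_intros assms definable_rename_term[OF assms])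

lemma vfinite_vempty: "vfinite vempty"
  unfolding vfinite_def using equipotent_refl vempty_omega by blast

text \<open>Induction on the number equipotent to \<open>F\<close>, for all \<open>F\<close> at
  once. The element removed in the step is the one matched with the top member \<open>n\<close> of
  \<open>vsucc n\<close>.\<close>

lemma vfinite_induct [consumes 1, case_names definable empty insert]:
  assumes "vfinite F" and P: "definable (\<lambda>e. P (e 0))" and "P vempty"
    and insert: "\<And>F a. P F \<Longrightarrow> P (vset (insert a (elts F)))"
  shows "P F"
proof -
  have "\<forall>F. equipotent F n \<longrightarrow> P F" if "n \<in> elts omega" for n
    using that
  proof (induction rule: omega_induct)
    case definable show ?case by (intro definable_intros P)
  next
    case zero
    have "F = vempty" if "equipotent F vempty" for F
      using that unfolding equipotent_iff bij_rel_def by auto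
    then show ?case using \<open>P vempty\<close> by blast
  next
    case (succ n)
    show ?case
    proof (intro allI impI)
      fix F assume "equipotent F (vsucc n)"
      then obtain f where f: "bij_rel f F (vsucc n)" unfolding equipotent_iff by blast
      then obtain a where a: "a \<in> elts F" "vpair a n \<in> elts f"
        unfolding bij_rel_def by auto
      let ?G = "vset (elts F - {a})"
      have G: "elts ?G = elts F - {a}" by simp
      have "equipotent ?G n"
      proof (rule equipotentI[of "\<lambda>x y. vpair x y \<in> elts f"], unfold G)
        show "definable (\<lambda>e. vpair (e 0) (e (Suc 0)) \<in> elts f)" by (intro definable_intros)
        show "\<exists>y\<in>elts n. vpair x y \<in> elts f" if "x \<in> elts F - {a}" for x
          using f a that unfolding bij_rel_def elts_vsucc by blast
        show "\<exists>x\<in>elts F - {a}. vpair x y \<in> elts f" if "y \<in> elts n" for y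
          using f a that mem_irrefl[of n] unfolding bij_rel_def elts_vsucc by blast
      qed (use f in \<open>unfold bij_rel_def elts_vsucc, blast\<close>)
      then have "P ?G" using succ by blast
      then have "P (vset (insert a (elts ?G)))" by (rule insert)
      moreover have "insert a (elts ?G) = elts F" using a G by blast
      ultimately show "P F" by (simp only: vset_elts)
    qed
  qed
  then show ?thesis using assms(1) unfolding vfinite_def by blast
qed

lemma vfinite_insert:
  assumes "vfinite F" shows "vfinite (vset (insert a (elts F)))"
proof (cases "a \<in> elts F")
  case True
  then show ?thesis using assms by (simp add: insert_absorb)
next
  case False
  obtain n f where n: "n \<in> elts omega" and f: "bij_rel f F n"
    using assms unfolding vfinite_def equipotent_iff by blast
  \<comment> \<open>The old witness may contain stray pairs involving \<open>a\<close> or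
    \<open>n\<close>, so it is restricted to \<open>F\<close> and \<open>n\<close> before the new
    pair is added.\<close>
  have "equipotent (vset (insert a (elts F))) (vsucc n)"
  proof (rule equipotentI[of "\<lambda>x y. x \<in> elts F \<and> y \<in> elts n \<and> vpair x y \<in> elts f \<or> x = a \<and> y = n"],
      unfold elts_vset_insert elts_vsucc)
    show "definable (\<lambda>e. e 0 \<in> elts F \<and> e (Suc 0) \<in> elts n \<and> vpair (e 0) (e (Suc 0)) \<in> elts f \<or>
        e 0 = a \<and> e (Suc 0) = n)" by (intro definable_intros)
    show "x = x' \<longleftrightarrow> y = y'"
      if "x \<in> elts F \<and> y \<in> elts n \<and> vpair x y \<in> elts f \<or> x = a \<and> y = n"
        "x' \<in> elts F \<and> y' \<in> elts n \<and> vpair x' y' \<in> elts f \<or> x' = a \<and> y' = n" for x y x' y'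
      using that f False mem_irrefl[of n] unfolding bij_rel_def by metis
  qed (use f in \<open>unfold bij_rel_def, blast+\<close>)
  then show ?thesis unfolding vfinite_def using n by auto
qed

lemma vfinite_subset:
  assumes "vfinite F" "elts G \<subseteq> elts F" shows "vfinite G"
proof -
  have "\<forall>G. elts G \<subseteq> elts F \<longrightarrow> vfinite G"
    using assms(1)
  proof (induction rule: vfinite_induct)
    case definable show ?case by (intro definable_intros)
  next
    case empty show ?case using vfinite_vempty by auto
  next
    case (insert F a)
    show ?case
    proof (intro allI impI)
      fix G assume G: "elts G \<subseteq> elts (vset (insert a (elts F)))"
      let ?H = "vset (elts G - {a})"
      have "elts ?H \<subseteq> elts F" using G by auto
      then have H: "vfinite ?H" using insert by blast
      show "vfinite G"
      proof (cases "a \<in> elts G")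
        case True
        then have "insert a (elts ?H) = elts G" by auto
        then show ?thesis using vfinite_insert[OF H, of a] by (simp only: vset_elts)
      next
        case False
        then have "elts ?H = elts G" by auto
        then show ?thesis using H by (simp only: elts_eq_iff)
      qed
    qed
  qed
  then show ?thesis using assms(2) by blast
qed

text \<open>\<open>H\<close> is any set covered by the two rather than their union, so that the
  induction hypothesis applies to what remains after removing a point. The inclusion is written
  memberwise in the induction to fit the definability rules.\<close>

lemma vfinite_subset_Un:
  assumes "vfinite F" "vfinite G" "elts H \<subseteq> elts F \<union> elts G" shows "vfinite H"
proof -
  have "\<forall>H. (\<forall>z\<in>elts H. z \<in> elts F \<or> z \<in> elts G) \<longrightarrow> vfinite H"
    using assms(1)
  proof (induction rule: vfinite_induct)
    case definable show ?case by (intro definable_intros)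
  next
    case empty
    show ?case
    proof (intro allI impI)
      fix H assume "\<forall>z\<in>elts H. z \<in> elts vempty \<or> z \<in> elts G"
      then have "elts H \<subseteq> elts G" by auto
      then show "vfinite H" using assms(2) vfinite_subset by blast
    qed
  next
    case (insert F a)
    show ?case
    proof (intro allI impI)
      fix H assume H: "\<forall>z\<in>elts H. z \<in> elts (vset (insert a (elts F))) \<or> z \<in> elts G"
      let ?K = "vset (elts H - {a})"
      have "\<forall>z\<in>elts ?K. z \<in> elts F \<or> z \<in> elts G" using H by auto
      then have "vfinite ?K" using insert by blast
      then have "vfinite (vset (insert a (elts ?K)))" by (rule vfinite_insert)
      then show "vfinite H" by (rule vfinite_subset) auto
    qed
  qed
  then show ?thesis using assms(3) by blast
qed

lemma vfinite_Union:
  assumes "vfinite \<F>" "\<And>F. F \<in> elts \<F> \<Longrightarrow> vfinite F" "elts H \<subseteq> (\<Union>F\<in>elts \<F>. elts F)"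
  shows "vfinite H"
proof -
  have "\<forall>H. (\<forall>F\<in>elts \<F>. vfinite F) \<and> (\<forall>z\<in>elts H. \<exists>F\<in>elts \<F>. z \<in> elts F) \<longrightarrow> vfinite H"
    using assms(1)
  proof (induction rule: vfinite_induct)
    case definable show ?case by (intro definable_intros)
  next
    case empty
    have "H = vempty" if "\<forall>z\<in>elts H. \<exists>F\<in>elts vempty. z \<in> elts F" for H :: 'a
      using that by (metis elts_eq_empty_iff elts_vempty empty_iff equals0I)
    then show ?case using vfinite_vempty by blast
  next
    case (insert \<F> F)
    show ?case
    proof (intro allI impI)
      fix H
      assume H: "(\<forall>G\<in>elts (vset (insert F (elts \<F>))). vfinite G) \<and>
        (\<forall>z\<in>elts H. \<exists>G\<in>elts (vset (insert F (elts \<F>))). z \<in> elts G)"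
      let ?K = "vset (elts H - elts F)"
      have "\<forall>z\<in>elts ?K. \<exists>G\<in>elts \<F>. z \<in> elts G" "\<forall>G\<in>elts \<F>. vfinite G" using H by auto
      then have "vfinite ?K" using insert by blast
      moreover have "vfinite F" using H by auto
      moreover have "elts H \<subseteq> elts ?K \<union> elts F" by auto
      ultimately show "vfinite H" by (rule vfinite_subset_Un)
    qed
  qed
  then show ?thesis using assms(2,3) by blast
qed

subsection \<open>Countable sets\<close>

text \<open>\<open>R\<close> enumerates \<open>A\<close>, possibly with repetitions and gaps.
  Matching each member with its least index gives a bijection onto a subset of
  \<open>omega\<close>.\<close>

lemma vcountableI:
  assumes R: "definable (\<lambda>e. R (e 0) (e (Suc 0)))"
    and ex: "\<And>a. a \<in> elts A \<Longrightarrow> \<exists>n\<in>elts omega. R n a"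
    and un: "\<And>n a b. n \<in> elts omega \<Longrightarrow> a \<in> elts A \<Longrightarrow> b \<in> elts A \<Longrightarrow> R n a \<Longrightarrow> R n b \<Longrightarrow> a = b"
  shows "vcountable A"
proof -
  define L where "L a n \<longleftrightarrow> n \<in> elts omega \<and> R n a \<and> (\<forall>m\<in>elts n. \<not> R m a)" for a n
  have L: "definable (\<lambda>e. L (e 0) (e (Suc 0)))"
    unfolding L_def by (intro definable_intros definable_app2[OF R])
  let ?S = "vset {n. n \<in> elts omega \<and> (\<exists>a\<in>elts A. L a n)}"
  have S: "elts ?S = {n. n \<in> elts omega \<and> (\<exists>a\<in>elts A. L a n)}"
  proof (rule vset_separation[of _ omega])
    show "definable (\<lambda>e. e 0 \<in> elts omega \<and> (\<exists>a\<in>elts A. L a (e 0)))"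
      by (intro definable_intros definable_app2[OF L])
  qed simp
  have exL: "\<exists>n. L a n" if a: "a \<in> elts A" for a
  proof -
    obtain n where n: "n \<in> elts omega" "R n a" using ex a by blast
    have "definable (\<lambda>e. R (e 0) a)" by (intro definable_intros definable_app2[OF R])
    from omega_least[OF this n] show ?thesis unfolding L_def by metis
  qed
  have "equipotent A ?S"
  proof (rule equipotentI[OF L])
    show "\<exists>n\<in>elts ?S. L a n" if "a \<in> elts A" for a
      using exL[OF that] that L_def unfolding S by blast
    show "\<exists>a\<in>elts A. L a n" if "n \<in> elts ?S" for n using that unfolding S by blast
    show "a = b \<longleftrightarrow> m = n"
      if "a \<in> elts A" "m \<in> elts ?S" "b \<in> elts A" "n \<in> elts ?S" "L a m" "L b n" for a b m n
      using that omega_linear[of m n] un[of m a b] unfolding L_def by blast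
  qed
  then show ?thesis unfolding vcountable_def using S by blast
qed

lemma vcountableE:
  assumes "vcountable A"
  obtains r where "\<forall>a\<in>elts A. \<exists>n\<in>elts omega. vpair n a \<in> elts r"
    "\<forall>n\<in>elts omega. \<forall>a\<in>elts A. \<forall>b\<in>elts A. vpair n a \<in> elts r \<longrightarrow> vpair n b \<in> elts r \<longrightarrow> a = b"
proof -
  obtain S where S: "elts S \<subseteq> elts omega" "equipotent S A"
    using assms equipotent_sym unfolding vcountable_def by blast
  then obtain f where f: "bij_rel f S A" unfolding equipotent_iff by blast
  \<comment> \<open>\<open>f\<close> may also relate numbers outside \<open>S\<close>, so it is cut
    down to \<open>S\<close> and \<open>A\<close> before uniqueness is claimed for every number in
    \<open>omega\<close>.\<close>
  have "definable (\<lambda>e. vpair (e 0) (e (Suc 0)) \<in> elts f)" by (intro definable_intros)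
  then obtain r where "elts r \<subseteq> elts (vtimes S A)"
    and r: "\<And>n a. vpair n a \<in> elts r \<longleftrightarrow> n \<in> elts S \<and> a \<in> elts A \<and> vpair n a \<in> elts f"
    using relation_exists[of "\<lambda>n a. vpair n a \<in> elts f" S A] by blast
  show ?thesis
    by (rule that[of r]) (use f S(1) in \<open>unfold bij_rel_def r, blast+\<close>)
qed

text \<open>The family need not be injective, so each member is enumerated at the least index that yields
  it; no choice is needed because \<open>S a\<close> is definable from \<open>a\<close>.\<close>

lemma countable_family:
  assumes "vcountable A" and S: "definable (\<lambda>e. e 0 \<in> S (e (Suc 0)))"
    and sub: "\<And>a. a \<in> elts A \<Longrightarrow> S a \<subseteq> elts X"
  obtains B where "vcountable B" "elts B = {b. \<exists>a\<in>elts A. elts b = S a}"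
    "elts ` elts B = S ` elts A"
proof -
  have S': "definable (\<lambda>e. t e \<in> S (s e))" if "definable_term t" "definable_term s" for t s
    by (rule definable_app2[where R = "\<lambda>x a. x \<in> S a", OF S that])
  let ?B = "vset {b. \<exists>a\<in>elts A. elts b = S a}"
  have B: "elts ?B = {b. \<exists>a\<in>elts A. elts b = S a}"
  proof (rule vset_separation[of _ "vPow X"])
    show "definable (\<lambda>e. \<exists>a\<in>elts A. elts (e 0) = S a)"
      unfolding set_eq_iff by (intro definable_intros S')
  qed (use sub in auto)
  obtain r where r: "\<forall>a\<in>elts A. \<exists>n\<in>elts omega. vpair n a \<in> elts r"
    "\<forall>n\<in>elts omega. \<forall>a\<in>elts A. \<forall>b\<in>elts A. vpair n a \<in> elts r \<longrightarrow> vpair n b \<in> elts r \<longrightarrow> a = b"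
    using vcountableE[OF assms(1)] .
  have "vcountable ?B"
  proof (rule vcountableI[of "\<lambda>n b. \<exists>a\<in>elts A. vpair n a \<in> elts r \<and> elts b = S a"], unfold B)
    show "definable (\<lambda>e. \<exists>a\<in>elts A. vpair (e 0) a \<in> elts r \<and> elts (e (Suc 0)) = S a)"
      unfolding set_eq_iff by (intro definable_intros S')
    show "\<exists>n\<in>elts omega. \<exists>a\<in>elts A. vpair n a \<in> elts r \<and> elts b = S a"
      if "b \<in> {b. \<exists>a\<in>elts A. elts b = S a}" for b
      using that r(1) by blast
    show "b = c" if n: "n \<in> elts omega" and b: "\<exists>a\<in>elts A. vpair n a \<in> elts r \<and> elts b = S a"
      and c: "\<exists>a\<in>elts A. vpair n a \<in> elts r \<and> elts c = S a" for n b c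
    proof -
      obtain a where a: "a \<in> elts A" "vpair n a \<in> elts r" "elts b = S a" using b by blast
      obtain a' where a': "a' \<in> elts A" "vpair n a' \<in> elts r" "elts c = S a'" using c by blast
      have "a = a'" using r(2) a a' n by blast
      then show ?thesis using a(3) a'(3) extensionality by metis
    qed
  qed
  moreover have "\<exists>b. elts b = S a" if "a \<in> elts A" for a
  proof -
    have "elts (vset {x. x \<in> S a}) = {x. x \<in> S a}"
      by (rule vset_separation[of _ X]) (intro S' definable_intros, use sub[OF that] in blast)
    then show ?thesis by auto
  qed
  then have "S a \<in> elts ` elts ?B" if "a \<in> elts A" for a
    using that unfolding B by (metis (mono_tags, lifting) image_eqI mem_Collect_eq)
  then have "elts ` elts ?B = S ` elts A" unfolding B by blast
  ultimately show ?thesis using that[of ?B] unfolding B by blast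
qed

text \<open>The singletons of \<open>A\<close> are a countable family of finite sets with union
  \<open>A\<close>.\<close>

lemma vcountable_imp_cuf:
  assumes "vcountable A" shows "cuf A"
proof -
  have "definable (\<lambda>e. e 0 \<in> {e (Suc 0)})" unfolding singleton_iff by (intro definable_intros)
  then obtain B where B: "vcountable B" "elts B = {b. \<exists>a\<in>elts A. elts b = {a}}"
    "elts ` elts B = (\<lambda>x. {x}) ` elts A"
    by (rule countable_family[where S = "\<lambda>x. {x}" and X = A, OF assms]) simp
  have "vfinite b" if b: "b \<in> elts B" for b
  proof -
    obtain a where a: "elts b = {a}" using b unfolding B(2) by blast
    have "vset {a} = b" unfolding a[symmetric] by (rule vset_elts)
    then show ?thesis using vfinite_insert[OF vfinite_vempty, of a] by simp
  qed
  moreover have "elts A = (\<Union>F\<in>elts B. elts F)" unfolding B(3) by simp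
  ultimately show ?thesis unfolding cuf_def using B(1) by blast
qed

text \<open>An infinite countable subset gives an injection that is not onto: send each of its elements
  to the next one in the enumeration.\<close>

lemma dedekind_infiniteI:
  assumes "vcountable A" "\<not> vfinite A" "elts A \<subseteq> elts D"
  shows "dedekind_infinite D"
proof -
  obtain S f where S: "elts S \<subseteq> elts omega" and f: "vfun f A S" and bij: "bij_betw (app f) (elts A) (elts S)"
    using assms(1) unfolding vcountable_def equipotent_def by blast
  have eq: "equipotent A S" using f bij unfolding equipotent_def by blast
  have inj: "x = y" if "x \<in> elts A" "y \<in> elts A" "app f x = app f y" for x y
    using bij that unfolding bij_betw_def inj_on_def by blast
  have surj: "\<exists>x\<in>elts A. app f x = k" if "k \<in> elts S" for k
    using bij that unfolding bij_betw_def by (metis imageE)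
  have in_S: "app f x \<in> elts S" if "x \<in> elts A" for x using app_in[OF f that] .
  have in_omega: "app f x \<in> elts omega" if "x \<in> elts A" for x using in_S[OF that] S by blast
  have infinite: "\<not> vfinite S"
    using assms(2) eq equipotent_trans unfolding vfinite_def by blast
  define next_in where "next_in m n \<longleftrightarrow> m \<in> elts n \<and> n \<in> elts S \<and> (\<forall>k\<in>elts S. m \<in> elts k \<longrightarrow> n = k \<or> n \<in> elts k)" for m n
  have next_in: "\<exists>n. next_in m n" if m: "m \<in> elts S" for m
  proof -
    have "\<exists>k\<in>elts S. m \<in> elts k"
    proof (rule ccontr)
      assume none: "\<not> (\<exists>k\<in>elts S. m \<in> elts k)"
      have "m \<in> elts omega" using m S by blast
      have "k \<in> elts (vsucc m)" if "k \<in> elts S" for k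
        using omega_linear[of k m] none that S \<open>m \<in> elts omega\<close> by auto
      moreover have "vfinite (vsucc m)"
        unfolding vfinite_def using equipotent_refl vsucc_omega[OF \<open>m \<in> elts omega\<close>] by blast
      ultimately show False using infinite vfinite_subset by blast
    qed
    then obtain k where k: "k \<in> elts omega" "k \<in> elts S \<and> m \<in> elts k" using S by blast
    have "definable (\<lambda>e. e 0 \<in> elts S \<and> m \<in> elts (e 0))" by (intro definable_intros)
    from omega_least[where P = "\<lambda>k. k \<in> elts S \<and> m \<in> elts k", OF this k]
    obtain n where n: "n \<in> elts omega" "n \<in> elts S \<and> m \<in> elts n"
      "\<And>k. k \<in> elts n \<Longrightarrow> \<not> (k \<in> elts S \<and> m \<in> elts k)" by metis
    have "n = k \<or> n \<in> elts k" if "k \<in> elts S" "m \<in> elts k" for k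
      using omega_linear[of n k] n that S by blast
    then show ?thesis unfolding next_in_def using n(2) by blast
  qed
  have next_inj: "m = m' \<longleftrightarrow> n = n'"
    if nx: "next_in m n" "next_in m' n'" and "m \<in> elts S" "m' \<in> elts S" for m n m' n'
  proof -
    have in_om: "m \<in> elts omega" "m' \<in> elts omega" "n \<in> elts omega" "n' \<in> elts omega"
      using that S unfolding next_in_def by blast+
    \<comment> \<open>If \<open>m\<close> comes before \<open>m'\<close>, then the next element
      after \<open>m\<close> is at most \<open>m'\<close>, and \<open>m'\<close> comes before the
      next element after it.\<close>
    have lt: "n \<noteq> n'" if "next_in m n" "next_in m' n'" "m \<in> elts m'" "m' \<in> elts S" "n \<in> elts omega" for m m' n n'
    proof
      assume "n = n'"
      have "n = m' \<or> n \<in> elts m'" using that(1,3,4) unfolding next_in_def by blast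
      moreover have "m' \<in> elts n" using that(2) \<open>n = n'\<close> unfolding next_in_def by blast
      ultimately show False using omega_asym[OF that(5)] mem_irrefl by blast
    qed
    show ?thesis
    proof
      assume "m = m'"
      then have "n = n' \<or> n \<in> elts n'" "n' = n \<or> n' \<in> elts n"
        using nx unfolding next_in_def by blast+
      then show "n = n'" using omega_asym[OF in_om(3)] by blast
    next
      assume n: "n = n'"
      have "m \<notin> elts m'" using lt[OF nx _ that(4) in_om(3)] n by blast
      moreover have "m' \<notin> elts m" using lt[OF nx(2,1) _ that(3) in_om(4)] n by blast
      ultimately show "m = m'" using omega_linear[OF in_om(1,2)] by blast
    qed
  qed
  define R where "R x y \<longleftrightarrow> x \<notin> elts A \<and> y = x \<or> x \<in> elts A \<and> y \<in> elts A \<and> next_in (app f x) (app f y)" for x y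
  have R: "definable (\<lambda>e. R (e 0) (e (Suc 0)))"
    unfolding R_def next_in_def by (intro definable_intros definable_term_app[OF f])
  let ?B = "vset {y. y \<in> elts D \<and> (\<exists>x\<in>elts D. R x y)}"
  have B: "elts ?B = {y. y \<in> elts D \<and> (\<exists>x\<in>elts D. R x y)}"
  proof (rule vset_separation[of _ D])
    show "definable (\<lambda>e. e 0 \<in> elts D \<and> (\<exists>x\<in>elts D. R x (e 0)))"
      by (intro definable_intros definable_app2[OF R])
  qed simp
  have "equipotent D ?B"
  proof (rule equipotentI[OF R])
    show "\<exists>y\<in>elts ?B. R x y" if x: "x \<in> elts D" for x
    proof (cases "x \<in> elts A")
      case True
      then obtain n where n: "next_in (app f x) n" using next_in in_S by blast
      then obtain y where "y \<in> elts A" "app f y = n" using surj unfolding next_in_def by blast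
      then have "R x y" "y \<in> elts D" using True n assms(3) unfolding R_def by auto
      then show ?thesis unfolding B using x by blast
    next
      case False
      then have "R x x" unfolding R_def by blast
      then show ?thesis unfolding B using x by blast
    qed
    show "\<exists>x\<in>elts D. R x y" if "y \<in> elts ?B" for y using that unfolding B by blast
    show "x = x' \<longleftrightarrow> y = y'" if "R x y" "R x' y'" for x y x' y'
    proof (cases "x \<in> elts A \<and> x' \<in> elts A")
      case True
      then have "app f x = app f x' \<longleftrightarrow> app f y = app f y'"
        using that in_S unfolding R_def by (intro next_inj) auto
      then show ?thesis using True that inj unfolding R_def by metis
    next
      case False
      then show ?thesis using that unfolding R_def by metis
    qed
  qed
  moreover have "elts ?B \<subset> elts D"
  proof -
    \<comment> \<open>The member of \<open>A\<close> with the least index follows nothing; it is the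
      point that the shift misses.\<close>
    have "S \<noteq> vempty" using infinite vfinite_vempty by blast
    then obtain k where k: "k \<in> elts omega" "k \<in> elts S" using elts_eq_empty_iff[of S] S by blast
    have "definable (\<lambda>e. e 0 \<in> elts S)" by (intro definable_intros)
    from omega_least[where P = "\<lambda>k. k \<in> elts S", OF this k]
    obtain m where m: "m \<in> elts S" "\<And>k. k \<in> elts m \<Longrightarrow> k \<notin> elts S" by metis
    obtain a where a: "a \<in> elts A" "app f a = m" using surj m(1) by blast
    have "\<not> R x a" for x
      unfolding R_def next_in_def using a m(2) in_S by blast
    then have "a \<notin> elts ?B" unfolding B by blast
    moreover have "a \<in> elts D" "elts ?B \<subseteq> elts D" using a(1) assms(3) unfolding B by auto
    ultimately show ?thesis by blast
  qed
  ultimately show ?thesis unfolding dedekind_infinite_def by blast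
qed

section \<open>Recursion along the natural numbers of the model\<close>

lemma vsucc_inject:
  assumes "m \<in> elts omega" "n \<in> elts omega" "vsucc m = vsucc n" shows "m = n"
proof -
  have "m \<in> elts (vsucc n)" "n \<in> elts (vsucc m)" using assms(3) by (metis elts_vsucc insertI1)+
  then show ?thesis using omega_asym[OF assms(1), of n] by auto
qed

lemma vsucc_neq_vempty [simp]: "vsucc n \<noteq> vempty"
  using elts_vsucc[of n] by (metis elts_vempty insert_not_empty)

text \<open>HOL recursion would only reach the standard stages. Instead, the graph \<open>r\<close>
  of the orbit is the least relation that contains the pair of 0 and \<open>z\<close> and is closed
  under the step \<open>H\<close>, obtained as an intersection of closed relations. \<open>H\<close>
  is a partial function on \<open>A\<close>, so each stage has at most one value and
  \<open>r\<close> enumerates the orbit; the orbit may stop.\<close>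

lemma countable_orbit:
  assumes z: "z \<in> elts A" and H: "definable (\<lambda>e. H (e 0) (e (Suc 0)))"
    and un: "\<And>x y y'. x \<in> elts A \<Longrightarrow> y \<in> elts A \<Longrightarrow> y' \<in> elts A \<Longrightarrow> H x y \<Longrightarrow> H x y' \<Longrightarrow> y = y'"
  obtains E where "vcountable E" "z \<in> elts E" "elts E \<subseteq> elts A"
    "\<And>x y. x \<in> elts E \<Longrightarrow> y \<in> elts A \<Longrightarrow> H x y \<Longrightarrow> y \<in> elts E"
proof -
  define closed where "closed K \<longleftrightarrow> vpair vempty z \<in> elts K \<and>
    (\<forall>n\<in>elts omega. \<forall>x\<in>elts A. \<forall>y\<in>elts A. vpair n x \<in> elts K \<longrightarrow> H x y \<longrightarrow> vpair (vsucc n) y \<in> elts K)" for K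
  define r where "r n x \<longleftrightarrow> n \<in> elts omega \<and> x \<in> elts A \<and> (\<forall>K. closed K \<longrightarrow> vpair n x \<in> elts K)" for n x
  have r: "definable (\<lambda>e. r (e 0) (e (Suc 0)))"
    unfolding r_def closed_def by (intro definable_intros definable_app2[OF H])
  have r_zero: "r vempty z" unfolding r_def closed_def using z by simp
  have r_succ: "r (vsucc n) y" if "r n x" "y \<in> elts A" "H x y" for n x y
    using that vsucc_omega[of n] unfolding r_def closed_def by blast
  \<comment> \<open>\<open>Q\<close> lists the two ways in which a pair can enter \<open>r\<close>.
    The relation it defines is itself closed, so minimality of \<open>r\<close> yields the inversion
    rule needed for uniqueness.\<close>
  define Q where "Q n x \<longleftrightarrow> n = vempty \<and> x = z \<or> (\<exists>m y. r m y \<and> n = vsucc m \<and> H y x)" for n x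
  have Q: "Q n x" if "r n x" for n x
  proof -
    have "definable (\<lambda>e. Q (e 0) (e (Suc 0)))"
      unfolding Q_def by (intro definable_intros definable_app2[OF H] definable_app2[OF r])
    then obtain K where "elts K \<subseteq> elts (vtimes omega A)"
      and K: "\<And>n x. vpair n x \<in> elts K \<longleftrightarrow> n \<in> elts omega \<and> x \<in> elts A \<and> Q n x"
      using relation_exists[of Q omega A] by blast
    have Qr: "r n x" if "Q n x" "x \<in> elts A" for n x
      using that r_zero r_succ unfolding Q_def by blast
    have "vpair (vsucc n) y \<in> elts K"
      if "n \<in> elts omega" "x \<in> elts A" "y \<in> elts A" "vpair n x \<in> elts K" "H x y" for n x y
    proof -
      have "r n x" using that K Qr by blast
      then have "Q (vsucc n) y" using that(5) unfolding Q_def by blast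
      then show ?thesis using that K by simp
    qed
    then have "closed K" unfolding closed_def using K z Q_def by simp
    then have "vpair n x \<in> elts K" using that unfolding r_def by blast
    then show ?thesis using K by blast
  qed
  have r_un: "\<forall>x y. r n x \<longrightarrow> r n y \<longrightarrow> x = y" if "n \<in> elts omega" for n
    using that
  proof (induction rule: omega_induct)
    case definable show ?case by (intro definable_intros definable_app2[OF r])
  next
    case zero
    have "x = z" if "r vempty x" for x using Q[OF that] vsucc_neq_vempty unfolding Q_def by metis
    then show ?case by blast
  next
    case (succ n)
    have pred: "\<exists>y. r n y \<and> H y x" if x: "r (vsucc n) x" for x
    proof -
      obtain m y where m: "r m y" "vsucc n = vsucc m" "H y x"
        using Q[OF x] vsucc_neq_vempty unfolding Q_def by metis
      then have "n = m" using vsucc_inject succ r_def by blast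
      then show ?thesis using m by blast
    qed
    show ?case
    proof (intro allI impI)
      fix x x' assume x: "r (vsucc n) x" "r (vsucc n) x'"
      obtain y y' where y: "r n y" "H y x" "r n y'" "H y' x'" using pred x by metis
      moreover have "y = y'" using y succ by blast
      ultimately show "x = x'" using un[of y x x'] x unfolding r_def by blast
    qed
  qed
  let ?E = "vset {x. x \<in> elts A \<and> (\<exists>n. r n x)}"
  have E: "elts ?E = {x. x \<in> elts A \<and> (\<exists>n. r n x)}"
  proof (rule vset_separation[of _ A])
    show "definable (\<lambda>e. e 0 \<in> elts A \<and> (\<exists>n. r n (e 0)))"
      by (intro definable_intros definable_app2[OF r])
  qed simp
  have "vcountable ?E"
  proof (rule vcountableI[OF r], unfold E)
    show "\<exists>n\<in>elts omega. r n x" if "x \<in> {x. x \<in> elts A \<and> (\<exists>n. r n x)}" for x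
      using that unfolding r_def by blast
    show "x = y" if "n \<in> elts omega" "r n x" "r n y" for n x y using r_un that by blast
  qed
  moreover have "z \<in> elts ?E" "elts ?E \<subseteq> elts A" unfolding E using z r_zero by blast+
  moreover have "y \<in> elts ?E" if "x \<in> elts ?E" "y \<in> elts A" "H x y" for x y
    using that r_succ unfolding E by blast
  ultimately show ?thesis using that by blast
qed

subsection \<open>Topological spaces\<close>

lemma vopen_elts [simp]: "vopen \<tau> (elts U) \<longleftrightarrow> U \<in> elts \<tau>"
  unfolding vopen_def elts_eq_iff by blast

lemma vopen_vempty: "is_topology X \<tau> \<Longrightarrow> vempty \<in> elts \<tau>"
  using vopen_elts[of \<tau> vempty] unfolding is_topology_def by simp

lemma vopen_subset: "is_topology X \<tau> \<Longrightarrow> vopen \<tau> A \<Longrightarrow> A \<subseteq> elts X"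
  unfolding is_topology_def vopen_def by blast

lemma vopen_Int: "is_topology X \<tau> \<Longrightarrow> vopen \<tau> A \<Longrightarrow> vopen \<tau> B \<Longrightarrow> vopen \<tau> (A \<inter> B)"
  unfolding is_topology_def vopen_def by (elim conjE bexE) blast

lemma definable_vopen [definable_intros]:
  assumes "definable_term t" "definable (\<lambda>e. e 0 \<in> A (\<lambda>n. e (Suc n)))"
  shows "definable (\<lambda>e. vopen (t e) (A e))"
proof -
  have A: "definable (\<lambda>e. e 0 \<in> A (\<lambda>n. e (Suc (Suc n))))"
    using definable_rename[OF assms(2), of "case_nat 0 (\<lambda>n. Suc (Suc n))"] by simp
  show ?thesis unfolding vopen_def set_eq_iff
    by (intro definable_intros assms definable_rename_term[OF assms(1)] A)
qed

text \<open>A topology is closed only under unions of families that are elements of the model.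
  Separation inside \<tau> collects the values of \<open>S\<close> into such a family.\<close>

lemma vopen_UN:
  assumes top: "is_topology X \<tau>" and S: "definable (\<lambda>e. e 0 \<in> S (e (Suc 0)))"
    and op: "\<And>a. a \<in> elts A \<Longrightarrow> vopen \<tau> (S a)"
  shows "vopen \<tau> (\<Union>a\<in>elts A. S a)"
proof -
  have S': "definable (\<lambda>e. t e \<in> S (s e))" if "definable_term t" "definable_term s" for t s
    by (rule definable_app2[where R = "\<lambda>x a. x \<in> S a", OF S that])
  let ?U = "vset {U. U \<in> elts \<tau> \<and> (\<exists>a\<in>elts A. elts U = S a)}"
  have U: "elts ?U = {U. U \<in> elts \<tau> \<and> (\<exists>a\<in>elts A. elts U = S a)}"
  proof (rule vset_separation[of _ \<tau>])
    show "definable (\<lambda>e. e 0 \<in> elts \<tau> \<and> (\<exists>a\<in>elts A. elts (e 0) = S a))"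
      unfolding set_eq_iff by (intro definable_intros S')
  qed simp
  have "S a \<in> elts ` elts ?U" if "a \<in> elts A" for a
    using op[OF that] that unfolding U vopen_def by blast
  moreover have "elts ` elts ?U \<subseteq> S ` elts A" unfolding U by blast
  ultimately have eq: "S ` elts A = elts ` elts ?U" by blast
  have "elts ?U \<subseteq> elts \<tau>" unfolding U by blast
  then show ?thesis using top unfolding is_topology_def eq by blast
qed

text \<open>The union of all open subsets of \<open>A\<close> replaces a selection of one
  neighbourhood for each point.\<close>

lemma vopen_locally:
  assumes "is_topology X \<tau>" "\<And>x. x \<in> elts A \<Longrightarrow> \<exists>U\<in>elts \<tau>. x \<in> elts U \<and> elts U \<subseteq> elts A"
  shows "A \<in> elts \<tau>"
proof -
  let ?U = "vset {U. U \<in> elts \<tau> \<and> elts U \<subseteq> elts A}"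
  have U: "elts ?U = {U. U \<in> elts \<tau> \<and> elts U \<subseteq> elts A}"
  proof (rule vset_separation[of _ \<tau>])
    show "definable (\<lambda>e. e 0 \<in> elts \<tau> \<and> elts (e 0) \<subseteq> elts A)" by (intro definable_intros)
  qed simp
  have "definable (\<lambda>e. e 0 \<in> elts (e (Suc 0)))" by (intro definable_intros)
  from vopen_UN[OF assms(1) this, of ?U] have "vopen \<tau> (\<Union>U\<in>elts ?U. elts U)"
    unfolding U by simp
  moreover have "(\<Union>U\<in>elts ?U. elts U) = elts A" unfolding U using assms(2) by blast
  ultimately show ?thesis by simp
qed

lemma discrete_spaceI:
  assumes top: "is_topology X \<tau>" and "\<And>x. x \<in> elts X \<Longrightarrow> vopen \<tau> {x}"
  shows "discrete_space X \<tau>"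
proof -
  have "A \<in> elts \<tau>" if A: "elts A \<subseteq> elts X" for A
  proof (rule vopen_locally[OF top])
    fix x assume "x \<in> elts A"
    moreover from this obtain U where "U \<in> elts \<tau>" "elts U = {x}"
      using assms(2)[of x] A unfolding vopen_def by blast
    ultimately show "\<exists>U\<in>elts \<tau>. x \<in> elts U \<and> elts U \<subseteq> elts A"
      by (intro bexI[of _ U]) auto
  qed
  then show ?thesis using top unfolding discrete_space_def is_topology_def by blast
qed

section \<open>Countable intersections of open sets\<close>

text \<open>A member of the family bounds the intersection; over the empty family HOL returns the
  whole universe, which is not an extension.\<close>

lemma elts_vset_INT:
  assumes "elts \<U> \<noteq> {}"
  shows "elts (vset (\<Inter>U\<in>elts \<U>. elts U)) = (\<Inter>U\<in>elts \<U>. elts U)"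
proof -
  obtain V where V: "V \<in> elts \<U>" using assms by blast
  have eq: "(\<Inter>U\<in>elts \<U>. elts U) = {x. \<forall>U\<in>elts \<U>. x \<in> elts U}" by blast
  show ?thesis unfolding eq
  proof (rule vset_separation[of _ V])
    show "definable (\<lambda>e. \<forall>U\<in>elts \<U>. e 0 \<in> elts U)" by (intro definable_intros)
  qed (use V in blast)
qed

lemma G_delta_INT:
  assumes "vcountable \<U>" "elts \<U> \<noteq> {}" "elts \<U> \<subseteq> elts \<tau>"
  shows "G_delta \<tau> (vset (\<Inter>U\<in>elts \<U>. elts U))"
  unfolding G_delta_def using assms elts_vset_INT by blast

lemma P_space_topology: "P_space X \<tau> \<Longrightarrow> is_topology X \<tau>"
  unfolding P_space_def by blast

lemma P_space_iff:
  assumes top: "is_topology X \<tau>"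
  shows "P_space X \<tau> \<longleftrightarrow> (\<forall>G. G_delta \<tau> G \<longrightarrow> G \<in> elts \<tau>)"
proof (intro iffI allI impI)
  fix G assume P: "P_space X \<tau>" and G: "G_delta \<tau> G"
  then have "elts G \<subseteq> elts X" using top unfolding G_delta_def is_topology_def by blast
  then show "G \<in> elts \<tau>"
    using P G unfolding P_space_def P_point_def interior_pts_def by (intro vopen_locally[OF top]) blast
next
  assume "\<forall>G. G_delta \<tau> G \<longrightarrow> G \<in> elts \<tau>"
  then show "P_space X \<tau>"
    using top unfolding P_space_def P_point_def interior_pts_def by blast
qed

lemma P_spaceI:
  assumes "is_topology X \<tau>"
    and "\<And>\<U>. vcountable \<U> \<Longrightarrow> elts \<U> \<noteq> {} \<Longrightarrow> elts \<U> \<subseteq> elts \<tau> \<Longrightarrow> vopen \<tau> (\<Inter>U\<in>elts \<U>. elts U)"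
  shows "P_space X \<tau>"
  unfolding P_space_iff[OF assms(1)] G_delta_def using assms(2) vopen_elts by metis

text \<open>The form in which the P-space property is applied: the index set is countable in the
  model, and the sets \<open>S a\<close> are given by a definable HOL map.
  \<open>countable_family\<close> turns them into a countable subset of \<tau>, to which the G-delta
  criterion applies.\<close>

lemma P_space_INT:
  assumes P: "P_space X \<tau>" and A: "vcountable A" "elts A \<noteq> {}"
    and S: "definable (\<lambda>e. e 0 \<in> S (e (Suc 0)))" and op: "\<And>a. a \<in> elts A \<Longrightarrow> vopen \<tau> (S a)"
  shows "vopen \<tau> (\<Inter>a\<in>elts A. S a)"
proof -
  have top: "is_topology X \<tau>" using P by (rule P_space_topology)
  have "\<And>a. a \<in> elts A \<Longrightarrow> S a \<subseteq> elts X" using vopen_subset[OF top op] .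
  from countable_family[OF A(1) S this] obtain B where B: "vcountable B"
    "elts B = {b. \<exists>a\<in>elts A. elts b = S a}" "elts ` elts B = S ` elts A" by blast
  have "B \<noteq> vempty" using B(3) A(2) by auto
  then have ne: "elts B \<noteq> {}" by simp
  have "elts B \<subseteq> elts \<tau>"
  proof
    fix b assume "b \<in> elts B"
    then obtain a where a: "a \<in> elts A" "elts b = S a" unfolding B(2) by blast
    have "vopen \<tau> (elts b)" unfolding a(2) using a(1) by (rule op)
    then show "b \<in> elts \<tau>" by simp
  qed
  then have "vset (\<Inter>U\<in>elts B. elts U) \<in> elts \<tau>"
    using G_delta_INT[OF B(1) ne] P P_space_iff[OF top] by blast
  then have "vopen \<tau> (\<Inter>U\<in>elts B. elts U)"
    using vopen_elts elts_vset_INT[OF ne] by metis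
  then show ?thesis unfolding B(3) .
qed

section \<open>Subspaces\<close>

lemma elts_subspace_topology:
  "elts (subspace_topology \<tau> Y) = {V. \<exists>U\<in>elts \<tau>. elts V = elts U \<inter> elts Y}"
  unfolding subspace_topology_def
proof (rule vset_separation[of _ "vPow Y"])
  show "definable (\<lambda>e. \<exists>U\<in>elts \<tau>. elts (e 0) = elts U \<inter> elts Y)"
    unfolding set_eq_iff Int_iff by (intro definable_intros)
qed auto

lemma vopen_subspace: "vopen (subspace_topology \<tau> Y) A \<longleftrightarrow> (\<exists>W. vopen \<tau> W \<and> A = W \<inter> elts Y)"
proof
  show "\<exists>W. vopen \<tau> W \<and> A = W \<inter> elts Y" if "vopen (subspace_topology \<tau> Y) A"
    using that unfolding vopen_def elts_subspace_topology by auto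
next
  assume "\<exists>W. vopen \<tau> W \<and> A = W \<inter> elts Y"
  then obtain U where U: "U \<in> elts \<tau>" "A = elts U \<inter> elts Y" unfolding vopen_def by blast
  have "vset (elts U \<inter> elts Y) \<in> elts (subspace_topology \<tau> Y)"
    unfolding elts_subspace_topology using U(1) by auto
  then show "vopen (subspace_topology \<tau> Y) A"
    unfolding vopen_def U(2) using elts_vset_Int by blast
qed

text \<open>To transfer a family of relatively open sets without choice, take the largest open set with
  a given trace.\<close>

definition largest_trace :: "'v::zf \<Rightarrow> 'v \<Rightarrow> 'v \<Rightarrow> 'v set" where
  "largest_trace \<tau> Y V = {x. \<exists>W\<in>elts \<tau>. x \<in> elts W \<and> (\<forall>z. z \<in> elts V \<longleftrightarrow> z \<in> elts W \<and> z \<in> elts Y)}"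

text \<open>If \<open>V\<close> is not the trace of any open set, the definition gives the empty
  set; so openness holds for every \<open>V\<close>, and only the last claim asks for a relatively
  open one.\<close>

lemma largest_trace:
  assumes top: "is_topology X \<tau>"
  shows "definable (\<lambda>e. e 0 \<in> largest_trace \<tau> Y (e (Suc 0)))"
    and "vopen \<tau> (largest_trace \<tau> Y V)"
    and "V \<in> elts (subspace_topology \<tau> Y) \<Longrightarrow> largest_trace \<tau> Y V \<inter> elts Y = elts V"
proof -
  let ?S = "largest_trace \<tau> Y"
  show "definable (\<lambda>e. e 0 \<in> ?S (e (Suc 0)))"
    unfolding largest_trace_def mem_Collect_eq by (intro definable_intros)
  have "elts (vset (?S V)) = ?S V" unfolding largest_trace_def
  proof (rule vset_separation[of _ X])
    show "definable (\<lambda>e. \<exists>W\<in>elts \<tau>. e 0 \<in> elts W \<and> (\<forall>z. z \<in> elts V \<longleftrightarrow> z \<in> elts W \<and> z \<in> elts Y))"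
      by (intro definable_intros)
  qed (use top in \<open>unfold is_topology_def, blast\<close>)
  moreover have "vset (?S V) \<in> elts \<tau>"
    by (rule vopen_locally[OF top]) (unfold calculation, unfold largest_trace_def, blast)
  ultimately show "vopen \<tau> (?S V)" unfolding vopen_def by blast
  assume "V \<in> elts (subspace_topology \<tau> Y)"
  then obtain U where "U \<in> elts \<tau>" "elts V = elts U \<inter> elts Y"
    unfolding elts_subspace_topology by blast
  then show "?S V \<inter> elts Y = elts V" unfolding largest_trace_def by blast
qed

lemma subspace_is_topology:
  assumes top: "is_topology X \<tau>" and Y: "elts Y \<subseteq> elts X"
  shows "is_topology Y (subspace_topology \<tau> Y)"
  unfolding is_topology_def
proof (intro conjI ballI allI impI)
  fix U V
  show "elts U \<subseteq> elts Y" if "U \<in> elts (subspace_topology \<tau> Y)"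
    using that unfolding elts_subspace_topology by blast
  show "vopen (subspace_topology \<tau> Y) (elts U \<inter> elts V)"
    if UV: "U \<in> elts (subspace_topology \<tau> Y)" "V \<in> elts (subspace_topology \<tau> Y)"
  proof -
    obtain U' V' where "vopen \<tau> U'" "elts U = U' \<inter> elts Y" "vopen \<tau> V'" "elts V = V' \<inter> elts Y"
      using UV[folded vopen_elts] unfolding vopen_subspace by blast
    then show ?thesis
      unfolding vopen_subspace by (intro exI[of _ "U' \<inter> V'"]) (use vopen_Int[OF top] in auto)
  qed
next
  show "vopen (subspace_topology \<tau> Y) {}"
    unfolding vopen_subspace using top unfolding is_topology_def by blast
  have "vopen (subspace_topology \<tau> Y) (elts Y)"
    unfolding vopen_subspace by (intro exI[of _ "elts X"]) (use top Y in \<open>auto simp: is_topology_def\<close>)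
  then show "Y \<in> elts (subspace_topology \<tau> Y)" by simp
next
  fix \<V> assume V: "elts \<V> \<subseteq> elts (subspace_topology \<tau> Y)"
  note S = largest_trace[OF top, where Y = Y]
  have "vopen \<tau> (\<Union>V\<in>elts \<V>. largest_trace \<tau> Y V)" by (rule vopen_UN[OF top S(1)]) (rule S(2))
  moreover have "(\<Union>V\<in>elts \<V>. elts V) = (\<Union>V\<in>elts \<V>. largest_trace \<tau> Y V \<inter> elts Y)"
    using S(3) V by (intro SUP_cong) auto
  then have "(\<Union>V\<in>elts \<V>. elts V) = (\<Union>V\<in>elts \<V>. largest_trace \<tau> Y V) \<inter> elts Y" by blast
  ultimately show "vopen (subspace_topology \<tau> Y) (\<Union>V\<in>elts \<V>. elts V)"
    unfolding vopen_subspace by blast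
qed

lemma P_space_subspace:
  assumes P: "P_space X \<tau>" and Y: "elts Y \<subseteq> elts X"
  shows "P_space Y (subspace_topology \<tau> Y)"
proof (rule P_spaceI)
  have top: "is_topology X \<tau>" using P by (rule P_space_topology)
  then show "is_topology Y (subspace_topology \<tau> Y)" using Y by (rule subspace_is_topology)
  fix \<V> assume V: "vcountable \<V>" "elts \<V> \<noteq> {}" "elts \<V> \<subseteq> elts (subspace_topology \<tau> Y)"
  note S = largest_trace[OF top, where Y = Y]
  have "vopen \<tau> (\<Inter>V\<in>elts \<V>. largest_trace \<tau> Y V)" by (rule P_space_INT[OF P V(1,2) S(1)]) (rule S(2))
  moreover have "(\<Inter>V\<in>elts \<V>. elts V) = (\<Inter>V\<in>elts \<V>. largest_trace \<tau> Y V \<inter> elts Y)"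
    using S(3) V(3) by (intro INF_cong) auto
  moreover have "\<dots> = (\<Inter>V\<in>elts \<V>. largest_trace \<tau> Y V) \<inter> elts Y"
    using V(2) by blast
  ultimately show "vopen (subspace_topology \<tau> Y) (\<Inter>V\<in>elts \<V>. elts V)"
    unfolding vopen_subspace by (intro exI[of _ "\<Inter>V\<in>elts \<V>. largest_trace \<tau> Y V"]) simp
qed

section \<open>Direct sums\<close>

text \<open>Taking the slice over \<open>j\<close> commutes with unions and with nonempty
  intersections, so each summand is treated separately and nothing is chosen across the index set.
  The codomain \<open>B\<close> of \<open>S\<close> serves to bound the set of points.\<close>

lemma P_space_sum:
  assumes S: "vfun S J B" and T: "vfun T J B'"
    and P: "\<And>j. j \<in> elts J \<Longrightarrow> P_space (app S j) (app T j)"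
  shows "P_space (sum_points J S) (sum_topology J S T)"
proof -
  have pts: "elts (sum_points J S) = {p. \<exists>j\<in>elts J. \<exists>x\<in>elts (app S j). p = vpair j x}"
    unfolding sum_points_def
  proof (rule vset_separation[of _ "vtimes J (vset (\<Union>y\<in>elts B. elts y))"])
    show "definable (\<lambda>e. \<exists>j\<in>elts J. \<exists>x\<in>elts (app S j). e 0 = vpair j x)"
      by (intro definable_intros definable_term_app[OF S])
    show "p \<in> elts (vtimes J (vset (\<Union>y\<in>elts B. elts y)))"
      if "\<exists>j\<in>elts J. \<exists>x\<in>elts (app S j). p = vpair j x" for p
      using that app_in[OF S] elts_vset_Union[of B] by auto
  qed
  define slice where "slice j A = {x \<in> elts (app S j). vpair j x \<in> A}" for j A
  have tau: "elts (sum_topology J S T) = {U. elts U \<subseteq> elts (sum_points J S) \<and>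
      (\<forall>j\<in>elts J. vopen (app T j) (slice j (elts U)))}"
    unfolding sum_topology_def slice_def
  proof (rule vset_separation[of _ "vPow (sum_points J S)"])
    show "definable (\<lambda>e. elts (e 0) \<subseteq> elts (sum_points J S) \<and>
        (\<forall>j\<in>elts J. vopen (app T j) {x \<in> elts (app S j). vpair j x \<in> elts (e 0)}))"
      by (intro definable_intros definable_term_app[OF S] definable_term_app[OF T], unfold mem_Collect_eq)
        (intro definable_intros definable_term_app[OF S])
  qed simp
  have slice_def': "definable (\<lambda>e. e 0 \<in> slice j (elts (e (Suc 0))))" for j
    unfolding slice_def mem_Collect_eq by (intro definable_intros)
  have openI: "vopen (sum_topology J S T) (elts U)"
    if "elts U \<subseteq> elts (sum_points J S)" "\<And>j. j \<in> elts J \<Longrightarrow> vopen (app T j) (slice j (elts U))" for U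
    using that unfolding vopen_elts tau by blast
  have top: "is_topology (app S j) (app T j)" if "j \<in> elts J" for j
    using P[OF that] by (rule P_space_topology)
  have sub: "elts U \<subseteq> elts (sum_points J S)" if "U \<in> elts (sum_topology J S T)" for U
    using that unfolding tau by blast
  have op: "vopen (app T j) (slice j (elts U))" if "U \<in> elts (sum_topology J S T)" "j \<in> elts J" for U j
    using that unfolding tau by blast
  show ?thesis
  proof (rule P_spaceI)
    show "is_topology (sum_points J S) (sum_topology J S T)"
      unfolding is_topology_def
    proof (intro conjI ballI allI impI)
      have "vopen (sum_topology J S T) (elts vempty)"
        by (rule openI) (use top in \<open>auto simp: slice_def is_topology_def\<close>)
      then show "vopen (sum_topology J S T) {}" by simp
      have "slice j (elts (sum_points J S)) = elts (app S j)" if "j \<in> elts J" for j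
        unfolding slice_def pts using that by auto
      then have "vopen (sum_topology J S T) (elts (sum_points J S))"
        by (intro openI) (use top in \<open>auto simp: is_topology_def\<close>)
      then show "sum_points J S \<in> elts (sum_topology J S T)" by simp
    next
      fix U V assume UV: "U \<in> elts (sum_topology J S T)" "V \<in> elts (sum_topology J S T)"
      have "slice j (elts U \<inter> elts V) = slice j (elts U) \<inter> slice j (elts V)" for j
        unfolding slice_def by blast
      then have "vopen (sum_topology J S T) (elts (vset (elts U \<inter> elts V)))"
        using sub[OF UV(1)] op[OF UV(1)] op[OF UV(2)] vopen_Int[OF top] by (intro openI) auto
      then show "vopen (sum_topology J S T) (elts U \<inter> elts V)" by simp
    next
      fix \<U> assume U: "elts \<U> \<subseteq> elts (sum_topology J S T)"
      have "slice j (\<Union>U\<in>elts \<U>. elts U) = (\<Union>U\<in>elts \<U>. slice j (elts U))" for j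
        unfolding slice_def by blast
      moreover have "vopen (app T j) (\<Union>U\<in>elts \<U>. slice j (elts U))" if "j \<in> elts J" for j
        by (rule vopen_UN[OF top[OF that] slice_def']) (use op that U in blast)
      moreover have "(\<Union>U\<in>elts \<U>. elts U) \<subseteq> elts (sum_points J S)" using sub U by blast
      ultimately have "vopen (sum_topology J S T) (elts (vset (\<Union>U\<in>elts \<U>. elts U)))"
        by (intro openI; unfold elts_vset_Union) auto
      then show "vopen (sum_topology J S T) (\<Union>U\<in>elts \<U>. elts U)" unfolding elts_vset_Union .
    qed (use sub in blast)
  next
    fix \<U> assume U: "vcountable \<U>" "elts \<U> \<noteq> {}" "elts \<U> \<subseteq> elts (sum_topology J S T)"
    have "slice j (\<Inter>U\<in>elts \<U>. elts U) = (\<Inter>U\<in>elts \<U>. slice j (elts U))" for j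
      unfolding slice_def using U(2) by blast
    moreover have "vopen (app T j) (\<Inter>U\<in>elts \<U>. slice j (elts U))" if "j \<in> elts J" for j
      by (rule P_space_INT[OF P[OF that] U(1,2) slice_def']) (use op that U in blast)
    moreover have "(\<Inter>U\<in>elts \<U>. elts U) \<subseteq> elts (sum_points J S)" using sub U(2,3) by blast
    ultimately have "vopen (sum_topology J S T) (elts (vset (\<Inter>U\<in>elts \<U>. elts U)))"
      by (intro openI; unfold elts_vset_INT[OF U(2)]) auto
    then show "vopen (sum_topology J S T) (\<Inter>U\<in>elts \<U>. elts U)" unfolding elts_vset_INT[OF U(2)] .
  qed
qed

section \<open>Cuf sets in T1 P-spaces\<close>

lemma vopen_Diff_finite:
  assumes top: "is_topology X \<tau>" and T1: "T1 X \<tau>" and "vfinite F"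
  shows "vopen \<tau> (elts X - elts F)"
  using assms(3)
proof (induction rule: vfinite_induct)
  case definable show ?case by (intro definable_intros) (unfold Diff_iff, intro definable_intros)
next
  case empty
  then show ?case using top unfolding is_topology_def by simp
next
  case (insert F a)
  have "vset (elts X - {a}) \<in> elts \<tau>"
  proof (rule vopen_locally[OF top], unfold elts_vset_remove)
    fix x assume x: "x \<in> elts X - {a}"
    show "\<exists>U\<in>elts \<tau>. x \<in> elts U \<and> elts U \<subseteq> elts X - {a}"
    proof (cases "a \<in> elts X")
      case True
      then obtain U where "U \<in> elts \<tau>" "x \<in> elts U" "a \<notin> elts U" using x T1 unfolding T1_def by blast
      then show ?thesis using top unfolding is_topology_def by blast
    next
      case False
      then show ?thesis using x top unfolding is_topology_def by blast
    qed
  qed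
  then have "vopen \<tau> (elts X - {a})" using vopen_elts elts_vset_remove by metis
  moreover have "elts X - elts (vset (insert a (elts F))) = (elts X - {a}) \<inter> (elts X - elts F)" by auto
  ultimately show ?case using vopen_Int[OF top] insert by metis
qed

text \<open>The parts of \<open>B\<close> in the finite pieces of \<open>Y\<close> are finite, hence
  have open complements, and there are countably many pieces. Allowing a subset \<open>B\<close>
  gives closedness (\<open>B = Y\<close>) as well as discreteness and the absence of accumulation
  points (\<open>Y\<close> without one point).\<close>

lemma vopen_Diff_cuf:
  assumes P: "P_space X \<tau>" and T1: "T1 X \<tau>" and "cuf Y" and B: "elts B \<subseteq> elts Y"
  shows "vopen \<tau> (elts X - elts B)"
proof -
  have top: "is_topology X \<tau>" using P by (rule P_space_topology)
  obtain \<F> where F: "vcountable \<F>" "\<forall>F\<in>elts \<F>. vfinite F" "elts Y = (\<Union>F\<in>elts \<F>. elts F)"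
    using assms(3) unfolding cuf_def by blast
  show ?thesis
  proof (cases "elts \<F> = {}")
    \<comment> \<open>An empty family of pieces would leave an empty intersection, so it is treated
      apart.\<close>
    case True
    then have "elts B = {}" using F(3) B by auto
    then show ?thesis using top unfolding is_topology_def by simp
  next
    case False
    define S where "S F = elts X - (elts F \<inter> elts B)" for F
    have "definable (\<lambda>e. e 0 \<in> S (e (Suc 0)))"
      unfolding S_def Diff_iff Int_iff by (intro definable_intros)
    moreover have "vopen \<tau> (S G)" if "G \<in> elts \<F>" for G
    proof -
      have "vfinite (vset (elts G \<inter> elts B))" using that F(2) vfinite_subset[of G] by simp
      from vopen_Diff_finite[OF top T1 this] show ?thesis unfolding S_def by simp
    qed
    ultimately have "vopen \<tau> (\<Inter>F\<in>elts \<F>. S F)" by (rule P_space_INT[OF P F(1) False])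
    moreover have "(\<Inter>F\<in>elts \<F>. S F) = elts X - elts B" unfolding S_def using False F(3) B by blast
    ultimately show ?thesis by simp
  qed
qed

lemma cuf_closed_discrete:
  assumes P: "P_space X \<tau>" and T1: "T1 X \<tau>" and "cuf Y" and Y: "elts Y \<subseteq> elts X"
  shows "vclosed X \<tau> Y" "discrete_space Y (subspace_topology \<tau> Y)"
proof -
  show "vclosed X \<tau> Y" unfolding vclosed_def using vopen_Diff_cuf[OF P T1 assms(3)] Y by blast
  have top: "is_topology Y (subspace_topology \<tau> Y)"
    using subspace_is_topology[OF P_space_topology[OF P] Y] .
  show "discrete_space Y (subspace_topology \<tau> Y)"
  proof (rule discrete_spaceI[OF top])
    fix x assume x: "x \<in> elts Y"
    have "vopen \<tau> (elts X - elts (vset (elts Y - {x})))"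
      by (rule vopen_Diff_cuf[OF P T1 assms(3)]) auto
    moreover have "{x} = (elts X - elts (vset (elts Y - {x}))) \<inter> elts Y" using x Y by auto
    ultimately show "vopen (subspace_topology \<tau> Y) {x}" unfolding vopen_subspace by blast
  qed
qed

lemma cuf_no_accumulation_point:
  assumes P: "P_space X \<tau>" and T1: "T1 X \<tau>" and "cuf Y"
  shows "\<not> accumulation_point X \<tau> Y x"
proof
  assume acc: "accumulation_point X \<tau> Y x"
  have "vopen \<tau> (elts X - elts (vset (elts Y - {x})))"
    by (rule vopen_Diff_cuf[OF P T1 assms(3)]) auto
  then obtain U where "U \<in> elts \<tau>" "elts U = elts X - (elts Y - {x})" unfolding vopen_def by auto
  then show False using acc unfolding accumulation_point_def by blast
qed

text \<open>The complement of a countable dense set is open and misses that set, so it is empty: the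
  whole space is countable, and complements of all its subsets are open.\<close>

lemma separable_P_space:
  assumes P: "P_space X \<tau>" and T1: "T1 X \<tau>" and "separable X \<tau>"
  shows "discrete_space X \<tau>" "vcountable X"
proof -
  have top: "is_topology X \<tau>" using P by (rule P_space_topology)
  obtain D where D: "elts D \<subseteq> elts X" "vcountable D" "vdense \<tau> (elts D)"
    using assms(3) unfolding separable_def by blast
  have cuf: "cuf D" using D(2) by (rule vcountable_imp_cuf)
  obtain U where U: "U \<in> elts \<tau>" "elts U = elts X - elts D"
    using vopen_Diff_cuf[OF P T1 cuf, of D] unfolding vopen_def by blast
  then have "elts X - elts D = {}" using D(3) unfolding vdense_def by blast
  then have "D = X" using D(1) by (intro extensionality) blast
  then show "vcountable X" using D(2) by simp
  show "discrete_space X \<tau>"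
  proof (rule discrete_spaceI[OF top])
    fix x assume x: "x \<in> elts X"
    have "vopen \<tau> (elts X - elts (vset (elts X - {x})))"
      by (rule vopen_Diff_cuf[OF P T1 cuf]) (auto simp: \<open>D = X\<close>)
    moreover have "{x} = elts X - elts (vset (elts X - {x}))" using x by auto
    ultimately show "vopen \<tau> {x}" by simp
  qed
qed

section \<open>Finiteness, countability and category conditions on the space\<close>

lemma P_space_weakly_dedekind_finite:
  assumes top: "is_topology X \<tau>" and "weakly_dedekind_finite X"
  shows "P_space X \<tau>"
proof (rule P_spaceI[OF top])
  fix \<U> assume U: "vcountable \<U>" "elts \<U> \<noteq> {}" "elts \<U> \<subseteq> elts \<tau>"
  have "elts \<U> \<subseteq> elts (vPow X)" using U(3) top unfolding is_topology_def by auto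
  then have "vfinite \<U>"
    using dedekind_infiniteI[OF U(1)] assms(2) unfolding weakly_dedekind_finite_def by blast
  \<comment> \<open>The induction starts with the empty family; the factor \<open>X\<close> makes
    its intersection an open set instead of the universe.\<close>
  then have "elts \<U> \<subseteq> elts \<tau> \<longrightarrow> vopen \<tau> (elts X \<inter> (\<Inter>U\<in>elts \<U>. elts U))"
  proof (induction rule: vfinite_induct)
    case definable show ?case
      by (intro definable_intros) (unfold Int_iff INT_iff, intro definable_intros)
  next
    case empty then show ?case using top unfolding is_topology_def by simp
  next
    case (insert \<U> V)
    show ?case
    proof
      assume *: "elts (vset (insert V (elts \<U>))) \<subseteq> elts \<tau>"
      have "elts X \<inter> (\<Inter>U\<in>elts (vset (insert V (elts \<U>))). elts U) =
          elts V \<inter> (elts X \<inter> (\<Inter>U\<in>elts \<U>. elts U))" by auto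
      moreover have "vopen \<tau> (elts V)" "vopen \<tau> (elts X \<inter> (\<Inter>U\<in>elts \<U>. elts U))"
        using * insert by auto
      ultimately show "vopen \<tau> (elts X \<inter> (\<Inter>U\<in>elts (vset (insert V (elts \<U>))). elts U))"
        using vopen_Int[OF top] by metis
    qed
  qed
  moreover have "elts X \<inter> (\<Inter>U\<in>elts \<U>. elts U) = (\<Inter>U\<in>elts \<U>. elts U)"
    using U(2,3) top unfolding is_topology_def by blast
  ultimately show "vopen \<tau> (\<Inter>U\<in>elts \<U>. elts U)" using U(3) by simp
qed

text \<open>By T1, a countable local base at \<open>x\<close> has intersection \<open>{x}\<close>,
  which is therefore open.\<close>

lemma first_countable_P_space:
  assumes P: "P_space X \<tau>" and T1: "T1 X \<tau>" and "first_countable X \<tau>"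
  shows "discrete_space X \<tau>"
proof (rule discrete_spaceI)
  show top: "is_topology X \<tau>" using P by (rule P_space_topology)
  fix x assume x: "x \<in> elts X"
  then obtain \<B> where B: "vcountable \<B>" "elts \<B> \<subseteq> elts \<tau>" "\<forall>V\<in>elts \<B>. x \<in> elts V"
    "\<forall>U\<in>elts \<tau>. x \<in> elts U \<longrightarrow> (\<exists>V\<in>elts \<B>. elts V \<subseteq> elts U)"
    using assms(3) unfolding first_countable_def by blast
  have X: "X \<in> elts \<tau>" using top unfolding is_topology_def by blast
  then have ne: "elts \<B> \<noteq> {}" using B(4) x by blast
  have "definable (\<lambda>e. e 0 \<in> elts (e (Suc 0)))" by (intro definable_intros)
  from P_space_INT[OF P B(1) ne this] have "vopen \<tau> (\<Inter>V\<in>elts \<B>. elts V)"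
    using B(2) by auto
  moreover have "y = x" if y: "y \<in> (\<Inter>V\<in>elts \<B>. elts V)" for y
  proof (rule ccontr)
    assume "y \<noteq> x"
    moreover obtain V where V: "V \<in> elts \<B>" using ne by blast
    then have "y \<in> elts X" using y B(2) top unfolding is_topology_def by blast
    ultimately obtain U where "U \<in> elts \<tau>" "x \<in> elts U" "y \<notin> elts U"
      using T1 x unfolding T1_def by metis
    then show False using B(4) y by blast
  qed
  then have "(\<Inter>V\<in>elts \<B>. elts V) = {x}" using B(3) by blast
  ultimately show "vopen \<tau> {x}" by simp
qed

text \<open>A denumerable family is countable and nonempty, so in a P-space the openness demanded by
  the strong form is automatic.\<close>

lemma P_space_baire_iff:
  assumes P: "P_space X \<tau>" shows "baire \<tau> \<longleftrightarrow> strongly_baire \<tau>"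
proof -
  have "vopen \<tau> (\<Inter>U\<in>elts \<U>. elts U)" if "denumerable \<U>" "\<forall>U\<in>elts \<U>. U \<in> elts \<tau>" for \<U>
  proof -
    have "\<U> \<noteq> vempty" using that(1) vfinite_vempty unfolding denumerable_def by blast
    then have ne: "elts \<U> \<noteq> {}" by simp
    have "definable (\<lambda>e. e 0 \<in> elts (e (Suc 0)))" by (intro definable_intros)
    from P_space_INT[OF P _ ne this] show ?thesis using that unfolding denumerable_def by simp
  qed
  then show ?thesis unfolding baire_def strongly_baire_def by blast
qed

text \<open>Adding the empty set to the nonempty open sets gives back \<tau>, so almost stability
  says that countable intersections of open sets are open.\<close>

lemma P_space_almost_stable_iff:
  assumes top: "is_topology X \<tau>"
  shows "P_space X \<tau> \<longleftrightarrow> almost_stable (vset (elts \<tau> - {vempty}))"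
proof -
  have "elts (vset (elts \<tau> - {vempty})) \<union> {vempty} = elts \<tau>"
    using vopen_vempty[OF top] by auto
  then have eq: "almost_stable (vset (elts \<tau> - {vempty})) \<longleftrightarrow>
      (\<forall>\<A>. vcountable \<A> \<and> elts \<A> \<noteq> {} \<and> elts \<A> \<subseteq> elts \<tau> \<longrightarrow> vopen \<tau> (\<Inter>A\<in>elts \<A>. elts A))"
    unfolding almost_stable_def vopen_def by simp
  have "definable (\<lambda>e. e 0 \<in> elts (e (Suc 0)))" by (intro definable_intros)
  note INT = P_space_INT[OF _ _ _ this]
  show ?thesis unfolding eq using INT[of X \<tau>] P_spaceI[OF top] vopen_elts by blast
qed

lemma vbase_nonempty_opens:
  "vbase \<tau> (vset (elts \<tau> - {vempty}))"
  unfolding vbase_def by auto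

subsection \<open>The real line\<close>

locale real_line =
  fixes R :: "'v::zf real_struct"
  assumes cof: "complete_ordered_field R"
begin

abbreviation "K \<equiv> elts (rcarrier R)"
abbreviation "r0 \<equiv> rzero R"
abbreviation "r1 \<equiv> rone R"
abbreviation "rsum \<equiv> radd R"
abbreviation "lt \<equiv> rlt R"

lemma field: "field (rring R)"
  using cof unfolding complete_ordered_field_def by blast

lemma carrier_eq: "carrier (rring R) = K"
  "x \<oplus>\<^bsub>rring R\<^esub> y = radd R x y" "x \<otimes>\<^bsub>rring R\<^esub> y = rmult R x y"
  "\<zero>\<^bsub>rring R\<^esub> = r0" "\<one>\<^bsub>rring R\<^esub> = r1"
  by (simp_all add: rring_def)

lemma lt_irrefl: "x \<in> K \<Longrightarrow> \<not> lt x x"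
  and lt_trans: "x \<in> K \<Longrightarrow> y \<in> K \<Longrightarrow> z \<in> K \<Longrightarrow> lt x y \<Longrightarrow> lt y z \<Longrightarrow> lt x z"
  and lt_linear: "x \<in> K \<Longrightarrow> y \<in> K \<Longrightarrow> lt x y \<or> x = y \<or> lt y x"
  and add_lt: "x \<in> K \<Longrightarrow> y \<in> K \<Longrightarrow> z \<in> K \<Longrightarrow> lt x y \<Longrightarrow> lt (rsum x z) (rsum y z)"
  and mult_pos: "x \<in> K \<Longrightarrow> y \<in> K \<Longrightarrow> lt r0 x \<Longrightarrow> lt r0 y \<Longrightarrow> lt r0 (rmult R x y)"
  using cof unfolding complete_ordered_field_def by blast+

lemma rplus_vfun: "vfun (rplus R) (vtimes (rcarrier R) (rcarrier R)) (rcarrier R)"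
  using cof unfolding complete_ordered_field_def by blast

lemma Sup_ex:
  assumes "elts S \<subseteq> K" "elts S \<noteq> {}" "b \<in> K" "\<And>x. x \<in> elts S \<Longrightarrow> rle R x b"
  obtains s where "s \<in> K" "\<And>x. x \<in> elts S \<Longrightarrow> rle R x s"
    "\<And>b. b \<in> K \<Longrightarrow> (\<And>x. x \<in> elts S \<Longrightarrow> rle R x b) \<Longrightarrow> rle R s b"
proof -
  have "\<forall>S. elts S \<subseteq> K \<and> elts S \<noteq> {} \<and> (\<exists>b\<in>K. \<forall>x\<in>elts S. rle R x b) \<longrightarrow>
      (\<exists>s\<in>K. (\<forall>x\<in>elts S. rle R x s) \<and> (\<forall>b\<in>K. (\<forall>x\<in>elts S. rle R x b) \<longrightarrow> rle R s b))"
    using cof unfolding complete_ordered_field_def by blast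
  then have "\<exists>s\<in>K. (\<forall>x\<in>elts S. rle R x s) \<and> (\<forall>b\<in>K. (\<forall>x\<in>elts S. rle R x b) \<longrightarrow> rle R s b)"
    using assms by blast
  then show ?thesis using that by blast
qed

lemma zero_K [simp]: "r0 \<in> K" and one_K [simp]: "r1 \<in> K" and one_neq_zero: "r1 \<noteq> r0"
  and add_K [simp]: "x \<in> K \<Longrightarrow> y \<in> K \<Longrightarrow> rsum x y \<in> K"
  and add_comm: "x \<in> K \<Longrightarrow> y \<in> K \<Longrightarrow> rsum x y = rsum y x"
  and add_assoc: "x \<in> K \<Longrightarrow> y \<in> K \<Longrightarrow> z \<in> K \<Longrightarrow> rsum (rsum x y) z = rsum x (rsum y z)"
  and zero_add [simp]: "x \<in> K \<Longrightarrow> rsum r0 x = x"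
  and add_zero [simp]: "x \<in> K \<Longrightarrow> rsum x r0 = x"
proof -
  interpret field "rring R" by (rule field)
  show "r0 \<in> K" using zero_closed unfolding carrier_eq .
  show "r1 \<in> K" using one_closed unfolding carrier_eq .
  show "r1 \<noteq> r0" using one_not_zero unfolding carrier_eq .
  show "x \<in> K \<Longrightarrow> y \<in> K \<Longrightarrow> rsum x y \<in> K" using a_closed[of x y] unfolding carrier_eq .
  show "x \<in> K \<Longrightarrow> y \<in> K \<Longrightarrow> rsum x y = rsum y x" using a_comm[of x y] unfolding carrier_eq .
  show "x \<in> K \<Longrightarrow> y \<in> K \<Longrightarrow> z \<in> K \<Longrightarrow> rsum (rsum x y) z = rsum x (rsum y z)"
    using a_assoc[of x y z] unfolding carrier_eq .
  show "x \<in> K \<Longrightarrow> rsum r0 x = x" using l_zero[of x] unfolding carrier_eq .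
  show "x \<in> K \<Longrightarrow> rsum x r0 = x" using r_zero[of x] unfolding carrier_eq .
qed

text \<open>Negatives and differences are used only through their existence. The formulas passed to
  separation then mention just \<open>rsum\<close> and \<open>lt\<close>, whose definability is
  available.\<close>

lemma neg_ex:
  assumes "x \<in> K" obtains y where "y \<in> K" "rsum x y = r0"
proof -
  interpret field "rring R" by (rule field)
  have x: "x \<in> carrier (rring R)" using assms unfolding carrier_eq .
  show ?thesis using that[of "\<ominus>\<^bsub>rring R\<^esub> x"] a_inv_closed[OF x] r_neg[OF x] unfolding carrier_eq .
qed

text \<open>If 1 were negative, then -1 would be positive, and so would its square, which is
  1.\<close>

lemma one_pos: "lt r0 r1"
proof (rule ccontr)
  assume n: "\<not> lt r0 r1"
  interpret field "rring R" by (rule field)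
  let ?m = "\<ominus>\<^bsub>rring R\<^esub> \<one>\<^bsub>rring R\<^esub>"
  have m: "?m \<in> carrier (rring R)" by simp
  have "lt r1 r0" using n lt_linear[OF zero_K one_K] one_neq_zero by metis
  from add_lt[OF one_K zero_K _ this, of ?m] m r_neg[OF one_closed] l_zero[OF m]
  have "lt r0 ?m" unfolding carrier_eq by simp
  from mult_pos[OF _ _ this this] m have "lt r0 (rmult R ?m ?m)" unfolding carrier_eq by blast
  moreover have "?m \<otimes>\<^bsub>rring R\<^esub> ?m = \<one>\<^bsub>rring R\<^esub>"
    using l_minus[OF one_closed m] l_one[OF m] minus_minus[OF one_closed] by simp
  ultimately show False using n unfolding carrier_eq by simp
qed

lemma lt_asym: "x \<in> K \<Longrightarrow> y \<in> K \<Longrightarrow> lt x y \<Longrightarrow> \<not> lt y x"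
  using lt_trans lt_irrefl by blast

lemma add_lt': "x \<in> K \<Longrightarrow> y \<in> K \<Longrightarrow> z \<in> K \<Longrightarrow> lt x y \<Longrightarrow> lt (rsum z x) (rsum z y)"
  using add_lt[of x y z] add_comm[of z] by simp

lemma add_lt_mono: "x \<in> K \<Longrightarrow> y \<in> K \<Longrightarrow> x' \<in> K \<Longrightarrow> y' \<in> K \<Longrightarrow> lt x y \<Longrightarrow> lt x' y' \<Longrightarrow> lt (rsum x x') (rsum y y')"
  using lt_trans[of "rsum x x'" "rsum y x'" "rsum y y'"] add_lt[of x y x'] add_lt'[of x' y' y] by simp

lemma diff_ex:
  assumes x: "x \<in> K" and y: "y \<in> K" obtains d where "d \<in> K" "rsum x d = y"
proof -
  obtain n where n: "n \<in> K" "rsum x n = r0" using neg_ex[OF x] .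
  have "rsum x (rsum n y) = y" using add_assoc[OF x n(1) y] n y by simp
  then show ?thesis using that[of "rsum n y"] n y by simp
qed

lemma pos_diff:
  assumes x: "x \<in> K" and y: "y \<in> K" and "lt x y" obtains d where "d \<in> K" "lt r0 d" "rsum x d = y"
proof -
  obtain d where d: "d \<in> K" "rsum x d = y" using diff_ex[OF x y] .
  have "\<not> lt d r0" using add_lt'[OF d(1) zero_K x] d x y assms(3) lt_asym by auto
  moreover have "d \<noteq> r0" using d x assms(3) lt_irrefl by auto
  ultimately have "lt r0 d" using lt_linear[OF zero_K d(1)] by blast
  then show ?thesis using that d by blast
qed

text \<open>Since 1 < 1 + 1, the element 1 + 1 is nonzero and has an inverse \<open>u\<close>. Then
  \<open>u\<close> added to itself is 1, and the half of \<open>x\<close> is \<open>u\<close> times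
  \<open>x\<close>.\<close>

lemma half_ex:
  assumes x: "x \<in> K" obtains h where "h \<in> K" "rsum h h = x"
proof -
  interpret field "rring R" by (rule field)
  let ?two = "\<one>\<^bsub>rring R\<^esub> \<oplus>\<^bsub>rring R\<^esub> \<one>\<^bsub>rring R\<^esub>"
  have "lt r1 (rsum r1 r1)" using add_lt[OF zero_K one_K one_K one_pos] by simp
  then have "rsum r1 r1 \<noteq> r0" using one_pos lt_asym[OF zero_K one_K] by metis
  then have "?two \<in> Units (rring R)" unfolding field_Units by (simp add: carrier_eq)
  then obtain u where u: "u \<in> carrier (rring R)" "?two \<otimes>\<^bsub>rring R\<^esub> u = \<one>\<^bsub>rring R\<^esub>"
    unfolding Units_def by blast
  have x': "x \<in> carrier (rring R)" using x unfolding carrier_eq .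
  have "u \<oplus>\<^bsub>rring R\<^esub> u = \<one>\<^bsub>rring R\<^esub>" using u l_distr[OF one_closed one_closed u(1)] by simp
  then have "u \<otimes>\<^bsub>rring R\<^esub> x \<oplus>\<^bsub>rring R\<^esub> u \<otimes>\<^bsub>rring R\<^esub> x = x"
    using l_distr[OF u(1) u(1) x'] x' by simp
  moreover have "u \<otimes>\<^bsub>rring R\<^esub> x \<in> carrier (rring R)" using u(1) x' by simp
  ultimately show ?thesis using that unfolding carrier_eq by blast
qed

lemma double_mono: "x \<in> K \<Longrightarrow> y \<in> K \<Longrightarrow> lt x y \<Longrightarrow> lt (rsum x x) (rsum y y)"
  using add_lt_mono by blast

lemma double_inject: "x \<in> K \<Longrightarrow> y \<in> K \<Longrightarrow> rsum x x = rsum y y \<Longrightarrow> x = y"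
  using double_mono[of x y] double_mono[of y x] lt_linear[of x y] lt_irrefl[of "rsum x x"] by auto

lemma half_pos:
  assumes "h \<in> K" "lt r0 (rsum h h)" shows "lt r0 h"
proof -
  have "\<not> lt h r0" using double_mono[OF assms(1) zero_K] assms lt_asym[of r0 "rsum h h"] by auto
  moreover have "h \<noteq> r0" using assms lt_irrefl by auto
  ultimately show ?thesis using lt_linear[OF assms(1) zero_K] by blast
qed

lemma definable_term_radd [definable_intros]:
  assumes "definable_term t" "definable_term s" shows "definable_term (\<lambda>e. rsum (t e) (s e))"
  unfolding radd_def by (intro definable_term_app[OF rplus_vfun] definable_intros assms)

lemma definable_rlt [definable_intros]:
  assumes "definable_term t" "definable_term s" shows "definable (\<lambda>e. lt (t e) (s e))"
  unfolding rlt_def by (intro definable_intros assms)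

text \<open>The orbit of 1 under halving. The supremum \<open>s\<close> of its lower bounds satisfies \<open>s + s \<le> s\<close>,
  so its infimum is 0.\<close>

lemma countable_null_set:
  obtains E where "vcountable E" "elts E \<noteq> {}" "\<And>x. x \<in> elts E \<Longrightarrow> x \<in> K \<and> lt r0 x"
    "\<And>d. d \<in> K \<Longrightarrow> lt r0 d \<Longrightarrow> \<exists>x\<in>elts E. lt x d"
proof -
  let ?P = "vset {x. x \<in> K \<and> lt r0 x}"
  have P: "elts ?P = {x. x \<in> K \<and> lt r0 x}"
  proof (rule vset_separation[of _ "rcarrier R"])
    show "definable (\<lambda>e. e 0 \<in> K \<and> lt r0 (e 0))" by (intro definable_intros)
  qed simp
  have "definable (\<lambda>e. rsum (e (Suc 0)) (e (Suc 0)) = e 0)" by (intro definable_intros)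
  from countable_orbit[where H = "\<lambda>x h. rsum h h = x" and z = r1 and A = ?P, OF _ this]
  obtain E where E: "vcountable E" "r1 \<in> elts E" "elts E \<subseteq> elts ?P"
    "\<And>x h. x \<in> elts E \<Longrightarrow> h \<in> elts ?P \<Longrightarrow> rsum h h = x \<Longrightarrow> h \<in> elts E"
    unfolding P using one_pos double_inject by (metis (mono_tags, lifting) mem_Collect_eq one_K)
  have pos: "x \<in> K \<and> lt r0 x" if "x \<in> elts E" for x using that E(3) unfolding P by blast
  have half: "\<exists>h\<in>elts E. rsum h h = x" if x: "x \<in> elts E" for x
  proof -
    obtain h where "h \<in> K" "rsum h h = x" using half_ex pos[OF x] by blast
    then show ?thesis using E(4)[OF x, of h] half_pos pos[OF x] unfolding P by blast
  qed
  let ?L = "vset {y. y \<in> K \<and> (\<forall>x\<in>elts E. \<not> lt x y)}"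
  have L: "elts ?L = {y. y \<in> K \<and> (\<forall>x\<in>elts E. \<not> lt x y)}"
  proof (rule vset_separation[of _ "rcarrier R"])
    show "definable (\<lambda>e. e 0 \<in> K \<and> (\<forall>x\<in>elts E. \<not> lt x (e 0)))" by (intro definable_intros)
  qed simp
  have L_le: "rle R y x" if "y \<in> elts ?L" "x \<in> elts E" for x y
    using that lt_linear[of x y] pos[of x] unfolding L rle_def by blast
  have zero_L: "r0 \<in> elts ?L" unfolding L using pos lt_asym[OF zero_K] by auto
  have LK: "elts ?L \<subseteq> K" "elts ?L \<noteq> {}" using zero_L unfolding L by blast+
  obtain s where s: "s \<in> K" "\<And>y. y \<in> elts ?L \<Longrightarrow> rle R y s"
    "\<And>b. b \<in> K \<Longrightarrow> (\<And>y. y \<in> elts ?L \<Longrightarrow> rle R y b) \<Longrightarrow> rle R s b"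
    using Sup_ex[OF LK one_K L_le[OF _ E(2)]] by blast
  have s_le: "rle R s x" if "x \<in> elts E" for x using s(3)[of x] L_le that pos by blast
  have s_zero: "s = r0"
  proof (rule ccontr)
    assume "s \<noteq> r0"
    then have "lt r0 s" using s(2)[OF zero_L] unfolding rle_def by blast
    then have "lt s (rsum s s)" using add_lt[OF zero_K s(1) s(1)] s(1) by simp
    then have "\<not> lt (rsum s s) s" "rsum s s \<noteq> s"
      using s(1) lt_asym[of s "rsum s s"] lt_irrefl[of s] by auto
    then have "rsum s s \<notin> elts ?L" using s(2)[of "rsum s s"] unfolding rle_def by blast
    then obtain x where x: "x \<in> elts E" "lt x (rsum s s)" unfolding L using s(1) by auto
    obtain h where h: "h \<in> elts E" "rsum h h = x" using half[OF x(1)] by blast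
    have "lt s h \<or> s = h" using s_le[OF h(1)] unfolding rle_def .
    then have "lt (rsum s s) x \<or> rsum s s = x" using double_mono[OF s(1)] pos[OF h(1)] h(2) by blast
    then show False using x(2) s(1) pos[OF x(1)] lt_asym[of x "rsum s s"] lt_irrefl[of x] by auto
  qed
  have "\<exists>x\<in>elts E. lt x d" if "d \<in> K" "lt r0 d" for d
  proof (rule ccontr)
    assume "\<not> (\<exists>x\<in>elts E. lt x d)"
    then have "d \<in> elts ?L" using that(1) unfolding L by blast
    then have "rle R d r0" using s(2) s_zero by blast
    then show False using that lt_asym[OF zero_K, of d] lt_irrefl[of d] unfolding rle_def by auto
  qed
  moreover have "elts E \<noteq> {}" using E(2) by blast
  ultimately show ?thesis using that E(1) pos by blast
qed

section \<open>Intervals and continuous real functions\<close>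

lemma elts_real_topology: "elts (real_topology R) = {U. elts U \<subseteq> K \<and>
     (\<forall>x\<in>elts U. \<exists>a\<in>K. \<exists>b\<in>K. lt a x \<and> lt x b \<and> {y \<in> K. lt a y \<and> lt y b} \<subseteq> elts U)}"
  unfolding real_topology_def
proof (rule vset_separation[of _ "vPow (rcarrier R)"])
  show "definable (\<lambda>e. elts (e 0) \<subseteq> K \<and>
     (\<forall>x\<in>elts (e 0). \<exists>a\<in>K. \<exists>b\<in>K. lt a x \<and> lt x b \<and> {y \<in> K. lt a y \<and> lt y b} \<subseteq> elts (e 0)))"
    unfolding subset_iff mem_Collect_eq by (intro definable_intros)
qed simp

lemma vopen_interval:
  assumes "a \<in> K" "b \<in> K" shows "vopen (real_topology R) {y \<in> K. lt a y \<and> lt y b}"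
proof -
  let ?U = "vset {y. y \<in> K \<and> lt a y \<and> lt y b}"
  have U: "elts ?U = {y. y \<in> K \<and> lt a y \<and> lt y b}"
  proof (rule vset_separation[of _ "rcarrier R"])
    show "definable (\<lambda>e. e 0 \<in> K \<and> lt a (e 0) \<and> lt (e 0) b)" by (intro definable_intros)
  qed simp
  have "?U \<in> elts (real_topology R)" unfolding elts_real_topology mem_Collect_eq U
    using assms by blast
  then show ?thesis unfolding vopen_def using U by blast
qed

text \<open>The interval from \<open>r - \<epsilon>\<close> to \<open>r + \<epsilon>\<close>, without subtraction.\<close>

definition nbhd :: "'v \<Rightarrow> 'v \<Rightarrow> 'v set" where
  "nbhd r \<epsilon> = {y. y \<in> K \<and> lt r (rsum y \<epsilon>) \<and> lt y (rsum r \<epsilon>)}"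

text \<open>\<open>nbhd\<close> is visibly definable in its radius, as families of such sets
  require; openness is known for sets given by endpoints. The endpoint \<open>a\<close> plays the
  part of r - \<epsilon>.\<close>

lemma nbhd_interval:
  assumes "r \<in> K" "\<epsilon> \<in> K" obtains a b where "a \<in> K" "b \<in> K" "nbhd r \<epsilon> = {y \<in> K. lt a y \<and> lt y b}"
proof -
  obtain a where a: "a \<in> K" "rsum \<epsilon> a = r" using diff_ex[OF assms(2,1)] .
  have "lt a y \<longleftrightarrow> lt r (rsum y \<epsilon>)" if y: "y \<in> K" for y
  proof
    show "lt r (rsum y \<epsilon>)" if "lt a y"
      using add_lt'[OF a(1) y assms(2) that] a y assms(2) add_comm by simp
    show "lt a y" if "lt r (rsum y \<epsilon>)"
    proof (rule ccontr)
      assume "\<not> lt a y"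
      then have "lt y a \<or> y = a" using lt_linear[OF a(1) y] by blast
      then have "lt (rsum \<epsilon> y) r \<or> rsum \<epsilon> y = r" using add_lt'[OF y a(1) assms(2)] a(2) by blast
      then show False
        using that lt_asym[of r "rsum y \<epsilon>"] lt_irrefl[of r] add_comm[OF y assms(2)] y assms by auto
    qed
  qed
  then have "nbhd r \<epsilon> = {y \<in> K. lt a y \<and> lt y (rsum r \<epsilon>)}" unfolding nbhd_def by blast
  then show ?thesis using that[of a "rsum r \<epsilon>"] a assms by simp
qed

text \<open>If \<open>y\<close> differs from \<open>r\<close>, let \<open>d\<close> be their
  distance: a radius below \<open>d\<close> gives a neighbourhood of \<open>r\<close> that excludes
  \<open>y\<close>.\<close>

lemma INT_nbhd:
  assumes E: "\<And>x. x \<in> elts E \<Longrightarrow> x \<in> K \<and> lt r0 x"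
    "\<And>d. d \<in> K \<Longrightarrow> lt r0 d \<Longrightarrow> \<exists>x\<in>elts E. lt x d"
    and ne: "elts E \<noteq> {}" and r: "r \<in> K"
  shows "(\<Inter>\<epsilon>\<in>elts E. nbhd r \<epsilon>) = {r}"
proof -
  have "r \<in> nbhd r \<epsilon>" if "\<epsilon> \<in> elts E" for \<epsilon>
    unfolding nbhd_def using E(1)[OF that] add_lt'[of r0 \<epsilon> r] r by simp
  moreover have "y = r" if y: "y \<in> (\<Inter>\<epsilon>\<in>elts E. nbhd r \<epsilon>)" for y
  proof (rule ccontr)
    assume "y \<noteq> r"
    have yK: "y \<in> K" using y ne unfolding nbhd_def by blast
    then consider "lt y r" | "lt r y" using lt_linear[OF yK r] \<open>y \<noteq> r\<close> by blast
    then show False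
    proof cases
      case 1
      then obtain d where d: "d \<in> K" "lt r0 d" "rsum y d = r" using pos_diff[OF yK r] by blast
      then obtain \<epsilon> where e: "\<epsilon> \<in> elts E" "lt \<epsilon> d" using E(2) by blast
      have "lt (rsum y \<epsilon>) r" using add_lt'[OF _ d(1) yK e(2)] E(1)[OF e(1)] d(3) by simp
      moreover have "lt r (rsum y \<epsilon>)" using y e(1) unfolding nbhd_def by blast
      ultimately show False using lt_asym[OF r, of "rsum y \<epsilon>"] E(1)[OF e(1)] yK by simp
    next
      case 2
      then obtain d where d: "d \<in> K" "lt r0 d" "rsum r d = y" using pos_diff[OF r yK] by blast
      then obtain \<epsilon> where e: "\<epsilon> \<in> elts E" "lt \<epsilon> d" using E(2) by blast
      have "lt (rsum r \<epsilon>) y" using add_lt'[OF _ d(1) r e(2)] E(1)[OF e(1)] d(3) by simp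
      moreover have "lt y (rsum r \<epsilon>)" using y e(1) unfolding nbhd_def by blast
      ultimately show False using lt_asym[OF yK, of "rsum r \<epsilon>"] E(1)[OF e(1)] r by simp
    qed
  qed
  ultimately show ?thesis using ne by blast
qed

text \<open>Continuity makes the preimages of the intervals around \<open>r\<close> open; with radii
  from the countable null set they intersect in the fibre.\<close>

lemma P_space_fibre:
  assumes P: "P_space X \<tau>" and f: "f \<in> C R X \<tau>" and r: "r \<in> K"
  shows "vopen \<tau> {x \<in> elts X. app f x = r}"
proof -
  have fv: "vfun f X (rcarrier R)" using f unfolding C_def cont_maps_def by blast
  obtain E where E: "vcountable E" "elts E \<noteq> {}" "\<And>x. x \<in> elts E \<Longrightarrow> x \<in> K \<and> lt r0 x"
    "\<And>d. d \<in> K \<Longrightarrow> lt r0 d \<Longrightarrow> \<exists>x\<in>elts E. lt x d" using countable_null_set by blast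
  define S where "S \<epsilon> = {x \<in> elts X. app f x \<in> nbhd r \<epsilon>}" for \<epsilon>
  have "definable (\<lambda>e. e 0 \<in> S (e (Suc 0)))"
    unfolding S_def nbhd_def mem_Collect_eq by (intro definable_intros definable_term_app[OF fv])
  moreover have "vopen \<tau> (S \<epsilon>)" if \<epsilon>: "\<epsilon> \<in> elts E" for \<epsilon>
  proof -
    obtain a b where ab: "a \<in> K" "b \<in> K" "nbhd r \<epsilon> = {y \<in> K. lt a y \<and> lt y b}"
      using nbhd_interval[OF r] E(3)[OF \<epsilon>] by blast
    then have "vopen (real_topology R) (nbhd r \<epsilon>)" using vopen_interval by simp
    then obtain V where "V \<in> elts (real_topology R)" "elts V = nbhd r \<epsilon>" unfolding vopen_def by blast
    then show ?thesis using f unfolding S_def C_def cont_maps_def by auto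
  qed
  ultimately have "vopen \<tau> (\<Inter>\<epsilon>\<in>elts E. S \<epsilon>)" by (rule P_space_INT[OF P E(1,2)])
  moreover have "(\<Inter>\<epsilon>\<in>elts E. S \<epsilon>) = {x \<in> elts X. app f x \<in> (\<Inter>\<epsilon>\<in>elts E. nbhd r \<epsilon>)}"
    unfolding S_def using E(2) by blast
  ultimately show ?thesis using INT_nbhd[OF E(3,4,2) r] by (simp only: singleton_iff)
qed

text \<open>A preimage is the union of the fibres over the values in \<open>V\<close>, all of them
  open. \<open>V\<close> is an arbitrary element of the model, so it is first cut down to
  reals.\<close>

lemma P_space_preimage:
  assumes P: "P_space X \<tau>" and f: "f \<in> C R X \<tau>"
  shows "vopen \<tau> {x \<in> elts X. app f x \<in> elts V}"
proof -
  have fv: "vfun f X (rcarrier R)" using f unfolding C_def cont_maps_def by blast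
  let ?S = "\<lambda>r. {x \<in> elts X. app f x = r}"
  have "definable (\<lambda>e. e 0 \<in> ?S (e (Suc 0)))"
    unfolding mem_Collect_eq by (intro definable_intros definable_term_app[OF fv])
  then have "vopen \<tau> (\<Union>r\<in>elts (vset (elts V \<inter> K)). ?S r)"
    by (rule vopen_UN[OF P_space_topology[OF P]]) (use P_space_fibre[OF P f] in simp)
  moreover have "(\<Union>r\<in>elts (vset (elts V \<inter> K)). ?S r) = {x \<in> elts X. app f x \<in> elts V}"
    unfolding elts_vset_Int using app_in[OF fv] by blast
  ultimately show ?thesis by simp
qed

lemma C_disc_eq:
  assumes P: "P_space X \<tau>" shows "C_disc R X \<tau> = C R X \<tau>"
proof
  have "elts (real_topology R) \<subseteq> elts (vPow (rcarrier R))" unfolding elts_real_topology by auto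
  then show "C_disc R X \<tau> \<subseteq> C R X \<tau>" unfolding C_disc_def C_def cont_maps_def by blast
  show "C R X \<tau> \<subseteq> C_disc R X \<tau>"
    using P_space_preimage[OF P] unfolding C_disc_def C_def cont_maps_def by blast
qed

text \<open>The complement is the preimage of the nonzero reals, hence open as well.\<close>

lemma zero_set_clopen:
  assumes P: "P_space X \<tau>" and "zero_set R X \<tau> Z"
  shows "clopen X \<tau> Z"
proof -
  obtain f where f: "f \<in> C R X \<tau>" and Z: "elts Z = {x \<in> elts X. app f x = r0}"
    using assms(2) unfolding zero_set_def by blast
  have fv: "vfun f X (rcarrier R)" using f unfolding C_def cont_maps_def by blast
  have "vopen \<tau> (elts Z)" unfolding Z by (rule P_space_fibre[OF P f zero_K])
  then have "Z \<in> elts \<tau>" by (simp only: vopen_elts)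
  moreover have "elts X - elts Z = {x \<in> elts X. app f x \<in> elts (vset (K - {r0}))}"
    unfolding Z elts_vset_remove using app_in[OF fv] by blast
  then have "vopen \<tau> (elts X - elts Z)" using P_space_preimage[OF P f] by (simp only:)
  moreover have "elts Z \<subseteq> elts X" unfolding Z by blast
  ultimately show ?thesis unfolding clopen_def vclosed_def by blast
qed

text \<open>The first zero-set is clopen, so it separates itself from the second.\<close>

lemma P_space_strongly_zero_dimensional:
  assumes "completely_regular R X \<tau>" "P_space X \<tau>"
  shows "strongly_zero_dimensional R X \<tau>"
  unfolding strongly_zero_dimensional_def
proof (intro conjI allI impI)
  fix Z1 Z2 assume Z: "zero_set R X \<tau> Z1 \<and> zero_set R X \<tau> Z2 \<and> elts Z1 \<inter> elts Z2 = {}"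
  have "clopen X \<tau> Z1" using zero_set_clopen[OF assms(2)] Z by blast
  moreover from this have "elts Z1 \<subseteq> elts X - elts Z2" unfolding clopen_def vclosed_def using Z by blast
  ultimately show "\<exists>U. clopen X \<tau> U \<and> elts Z1 \<subseteq> elts U \<and> elts U \<subseteq> elts X - elts Z2" by blast
qed (rule assms)

section \<open>Complete regularity and metrizability\<close>

text \<open>A clopen set is the co-zero set of its indicator function, and zero-sets are clopen in a
  P-space. This removes real functions from complete regularity.\<close>

lemma cozero_set_iff_clopen:
  assumes P: "P_space X \<tau>" shows "cozero_set R X \<tau> U \<longleftrightarrow> clopen X \<tau> U"
proof
  have top: "is_topology X \<tau>" using P by (rule P_space_topology)
  show "clopen X \<tau> U" if cz: "cozero_set R X \<tau> U"
  proof -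
    obtain Z where Z: "zero_set R X \<tau> Z" "elts U = elts X - elts Z"
      using cz unfolding cozero_set_def by blast
    have "clopen X \<tau> Z" using zero_set_clopen[OF P Z(1)] .
    then have *: "vopen \<tau> (elts X - elts Z)" "Z \<in> elts \<tau>" "elts Z \<subseteq> elts X"
      unfolding clopen_def vclosed_def by blast+
    have "elts X - elts U = elts Z" using Z(2) *(3) by blast
    then show ?thesis using *(1,2) Z(2)[symmetric] unfolding clopen_def vclosed_def by auto
  qed
  assume U: "clopen X \<tau> U"
  let ?h = "\<lambda>x. if x \<in> elts U then r1 else r0"
  have "definable (\<lambda>e. e 0 \<in> elts U \<and> e (Suc 0) = r1 \<or> e 0 \<notin> elts U \<and> e (Suc 0) = r0)"
    by (intro definable_intros)
  then obtain f where f: "vfun f X (rcarrier R)" "\<And>x. x \<in> elts X \<Longrightarrow> app f x = ?h x"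
    by (rule vfun_exists[of "\<lambda>x y. x \<in> elts U \<and> y = r1 \<or> x \<notin> elts U \<and> y = r0" X ?h "rcarrier R"]) auto
  have XU: "vopen \<tau> (elts U)" "vopen \<tau> (elts X - elts U)" "elts U \<subseteq> elts X" "vopen \<tau> (elts X)" "vopen \<tau> {}"
    using U top unfolding clopen_def vclosed_def is_topology_def by auto
  have "vopen \<tau> {x \<in> elts X. app f x \<in> elts V}" for V
  proof -
    have eq: "{x \<in> elts X. app f x \<in> elts V} = {x \<in> elts X. ?h x \<in> elts V}" using f(2) by auto
    \<comment> \<open>For a function with values 0 and 1, the preimage depends only on which of the
      two belong to \<open>V\<close>.\<close>
    have "{x \<in> elts X. ?h x \<in> elts V} \<in> {elts U, elts X - elts U, elts X, {}}"
    proof (cases "r1 \<in> elts V"; cases "r0 \<in> elts V")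
      assume "r1 \<in> elts V" "r0 \<notin> elts V"
      then have "{x \<in> elts X. ?h x \<in> elts V} = elts U" using XU(3) by auto
      then show ?thesis by blast
    next
      assume "r1 \<notin> elts V" "r0 \<in> elts V"
      then have "{x \<in> elts X. ?h x \<in> elts V} = elts X - elts U" by auto
      then show ?thesis by blast
    qed auto
    moreover have "\<forall>A\<in>{elts U, elts X - elts U, elts X, {}}. vopen \<tau> A" using XU by blast
    ultimately show ?thesis unfolding eq by blast
  qed
  then have "f \<in> C R X \<tau>" unfolding C_def cont_maps_def using f(1) by blast
  moreover have "elts (vset (elts X - elts U)) = {x \<in> elts X. app f x = r0}"
    using f(2) one_neq_zero by auto
  ultimately have "zero_set R X \<tau> (vset (elts X - elts U))" unfolding zero_set_def by blast
  moreover have "elts U = elts X - elts (vset (elts X - elts U))" using XU(3) by auto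
  ultimately show "cozero_set R X \<tau> U" unfolding cozero_set_def by blast
qed

text \<open>The definition speaks of \<open>vset\<close> of the co-zero sets, which is meaningful
  only if they form an element of the model. As clopen sets they are separated from \<tau> by a
  simple formula.\<close>

lemma P_space_completely_regularI:
  assumes P: "P_space X \<tau>"
    and base: "\<And>U x. U \<in> elts \<tau> \<Longrightarrow> x \<in> elts U \<Longrightarrow> \<exists>V. clopen X \<tau> V \<and> x \<in> elts V \<and> elts V \<subseteq> elts U"
  shows "completely_regular R X \<tau>"
proof -
  have "elts (vset {U. clopen X \<tau> U}) = {U. clopen X \<tau> U}"
  proof (rule vset_separation[of _ \<tau>])
    show "definable (\<lambda>e. clopen X \<tau> (e 0))"
      unfolding clopen_def vclosed_def by (intro definable_intros) (unfold Diff_iff, intro definable_intros)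
  qed (simp add: clopen_def)
  then show ?thesis
    unfolding completely_regular_def cozero_set_iff_clopen[OF P] vbase_def using base
    by (auto simp: clopen_def)
qed

text \<open>The balls around \<open>x\<close> with radii in the countable null set are open and have
  only \<open>x\<close> in common. The radii themselves index the family, so the argument needs no
  detour through countable local bases.\<close>

lemma metrizable_P_space:
  assumes P: "P_space X \<tau>" and "metrizable R X \<tau>"
  shows "discrete_space X \<tau>"
proof (rule discrete_spaceI)
  show "is_topology X \<tau>" using P by (rule P_space_topology)
  obtain d where d: "is_metric R X d" and \<tau>: "\<tau> = metric_topology R X d"
    using assms(2) unfolding metrizable_def by blast
  have fv: "vfun d (vtimes X X) (rcarrier R)" using d unfolding is_metric_def by blast
  have dK [simp]: "app d (vpair x y) \<in> K" if "x \<in> elts X" "y \<in> elts X" for x y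
    using app_in[OF fv] that by simp
  define ball where "ball x r = {y \<in> elts X. lt (app d (vpair x y)) r}" for x r
  have elts_\<tau>: "elts \<tau> = {U. elts U \<subseteq> elts X \<and>
      (\<forall>x\<in>elts U. \<exists>r\<in>K. lt r0 r \<and> ball x r \<subseteq> elts U)}"
    unfolding \<tau> metric_topology_def ball_def
  proof (rule vset_separation[of _ "vPow X"])
    show "definable (\<lambda>e. elts (e 0) \<subseteq> elts X \<and>
      (\<forall>x\<in>elts (e 0). \<exists>r\<in>K. lt r0 r \<and> {y \<in> elts X. lt (app d (vpair x y)) r} \<subseteq> elts (e 0)))"
      unfolding subset_iff mem_Collect_eq by (intro definable_intros definable_term_app[OF fv])
  qed simp
  fix x assume x: "x \<in> elts X"
  have metric: "rle R r0 (app d (vpair x y)) \<and> (app d (vpair x y) = r0 \<longleftrightarrow> x = y)"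
    if y: "y \<in> elts X" for y
  proof -
    have "\<forall>x\<in>elts X. \<forall>y\<in>elts X. rle R r0 (app d (vpair x y)) \<and>
        (app d (vpair x y) = r0 \<longleftrightarrow> x = y) \<and> app d (vpair x y) = app d (vpair y x)"
      using d unfolding is_metric_def by (elim conjE)
    from bspec[OF bspec[OF this x] y] show ?thesis by (elim conjE) (intro conjI)
  qed
  have self: "app d (vpair x x) = r0" using metric[OF x] by simp
  have ball_open: "vopen \<tau> (ball x r)" if r: "r \<in> K" for r
  proof -
    let ?B = "vset {y. y \<in> elts X \<and> lt (app d (vpair x y)) r}"
    have B: "elts ?B = ball x r" unfolding ball_def
    proof (rule vset_separation[of _ X])
      show "definable (\<lambda>e. e 0 \<in> elts X \<and> lt (app d (vpair x (e 0))) r)"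
        by (intro definable_intros definable_term_app[OF fv])
    qed simp
    have "\<exists>s\<in>K. lt r0 s \<and> ball y s \<subseteq> ball x r" if y: "y \<in> ball x r" for y
    proof -
      have yX: "y \<in> elts X" and lty: "lt (app d (vpair x y)) r" using y unfolding ball_def by auto
      \<comment> \<open>The radius \<open>s\<close> is what remains of \<open>r\<close> after the
        distance from \<open>x\<close> to \<open>y\<close>; the triangle inequality keeps the ball
        around \<open>y\<close> inside.\<close>
      obtain s where s: "s \<in> K" "lt r0 s" "rsum (app d (vpair x y)) s = r"
        using pos_diff[OF dK[OF x yX] r lty] .
      have "z \<in> ball x r" if z: "z \<in> ball y s" for z
      proof -
        have zX: "z \<in> elts X" and ltz: "lt (app d (vpair y z)) s" using z unfolding ball_def by auto
        have "rle R (app d (vpair x z)) (rsum (app d (vpair x y)) (app d (vpair y z)))"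
          using d x yX zX unfolding is_metric_def by blast
        moreover have "lt (rsum (app d (vpair x y)) (app d (vpair y z))) r"
          using add_lt'[OF dK[OF yX zX] s(1) dK[OF x yX] ltz] s(3) by simp
        ultimately have "lt (app d (vpair x z)) r"
          unfolding rle_def using lt_trans[OF dK[OF x zX] add_K[OF dK[OF x yX] dK[OF yX zX]] r] by auto
        then show ?thesis unfolding ball_def using zX by blast
      qed
      then show ?thesis using s by blast
    qed
    moreover have "ball x r \<subseteq> elts X" unfolding ball_def by blast
    ultimately have "?B \<in> elts \<tau>" unfolding elts_\<tau> mem_Collect_eq B by blast
    then show ?thesis unfolding vopen_def using B by blast
  qed
  obtain E where E: "vcountable E" "elts E \<noteq> {}" "\<And>x. x \<in> elts E \<Longrightarrow> x \<in> K \<and> lt r0 x"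
    "\<And>d. d \<in> K \<Longrightarrow> lt r0 d \<Longrightarrow> \<exists>x\<in>elts E. lt x d" using countable_null_set by blast
  have "definable (\<lambda>e. e 0 \<in> ball x (e (Suc 0)))"
    unfolding ball_def mem_Collect_eq by (intro definable_intros definable_term_app[OF fv])
  then have "vopen \<tau> (\<Inter>\<epsilon>\<in>elts E. ball x \<epsilon>)"
    by (rule P_space_INT[OF P E(1,2)]) (use ball_open E(3) in blast)
  moreover have "y = x" if y: "y \<in> (\<Inter>\<epsilon>\<in>elts E. ball x \<epsilon>)" for y
  proof (rule ccontr)
    assume "y \<noteq> x"
    have yX: "y \<in> elts X" using y E(2) unfolding ball_def by blast
    have "rle R r0 (app d (vpair x y))" "app d (vpair x y) \<noteq> r0"
      using metric yX \<open>y \<noteq> x\<close> by auto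
    then have "lt r0 (app d (vpair x y))" unfolding rle_def by auto
    then obtain \<epsilon> where e: "\<epsilon> \<in> elts E" "lt \<epsilon> (app d (vpair x y))" using E(4) dK[OF x yX] by blast
    then have "lt (app d (vpair x y)) \<epsilon>" using y unfolding ball_def by blast
    then show False using e lt_asym[OF _ dK[OF x yX], of \<epsilon>] E(3) by blast
  qed
  then have "(\<Inter>\<epsilon>\<in>elts E. ball x \<epsilon>) = {x}"
    using E(2,3) x unfolding ball_def by (auto simp: self)
  ultimately show "vopen \<tau> {x}" by simp
qed

end

subsection \<open>The one-point compactification\<close>

lemma definable_term_Diff [definable_intros]:
  assumes "definable_term t" "definable_term s"
  shows "definable_term (\<lambda>e. vset (elts (t e) - elts (s e)))"
  unfolding set_diff_eq
  by (rule definable_term_vset) (intro definable_intros assms[THEN definable_rename_term],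
    rule elts_vset_Diff[unfolded set_diff_eq])

lemma elts_finite_subsets: "elts (finite_subsets A) = {F. elts F \<subseteq> elts A \<and> vfinite F}"
  unfolding finite_subsets_def
proof (rule vset_separation[of _ "vPow A"])
  show "definable (\<lambda>e. elts (e 0) \<subseteq> elts A \<and> vfinite (e 0))" by (intro definable_intros)
qed simp

lemma elts_one_point_points: "elts (one_point_points X pt) = insert pt (elts X)"
  unfolding one_point_points_def by simp

text \<open>One condition replaces the two kinds of open sets: a set containing \<open>pt\<close>
  must have finite complement in \<open>X\<close>. Closure under unions and intersections then needs
  no case distinction between the kinds.\<close>

lemma elts_one_point_topology:
  assumes "pt \<notin> elts X"
  shows "elts (one_point_topology X pt) =
    {U. elts U \<subseteq> insert pt (elts X) \<and> (pt \<in> elts U \<longrightarrow> vfinite (vset (elts X - elts U)))}"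
proof -
  have eq: "{U. elts U \<subseteq> elts X} \<union> {U. \<exists>F. elts F \<subseteq> elts X \<and> vfinite F \<and> elts U = insert pt (elts X) - elts F}
    = {U. elts U \<subseteq> insert pt (elts X) \<and> (pt \<in> elts U \<longrightarrow> vfinite (vset (elts X - elts U)))}" (is "?A = ?B")
  proof
    have "vset (elts X - (insert pt (elts X) - elts F)) = F" if "elts F \<subseteq> elts X" for F
    proof -
      have "elts X - (insert pt (elts X) - elts F) = elts F" using that by blast
      then show ?thesis by simp
    qed
    then show "?A \<subseteq> ?B" using assms by auto
    have "U \<in> ?A" if U: "U \<in> ?B" for U
    proof (cases "pt \<in> elts U")
      case True
      then have "elts U = insert pt (elts X) - elts (vset (elts X - elts U))" using U assms by auto
      moreover have "elts (vset (elts X - elts U)) \<subseteq> elts X" by auto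
      ultimately show ?thesis using U True by blast
    qed (use U in auto)
    then show "?B \<subseteq> ?A" by blast
  qed
  have "elts (vset ?B) = ?B"
  proof (rule vset_separation[of _ "vPow (one_point_points X pt)"])
    show "definable (\<lambda>e. elts (e 0) \<subseteq> insert pt (elts X) \<and> (pt \<in> elts (e 0) \<longrightarrow> vfinite (vset (elts X - elts (e 0)))))"
      unfolding elts_one_point_points[symmetric] by (intro definable_intros)
  qed (simp add: elts_one_point_points)
  then show ?thesis unfolding one_point_topology_def eq .
qed

lemma one_point_is_topology:
  assumes pt: "pt \<notin> elts X"
  shows "is_topology (one_point_points X pt) (one_point_topology X pt)"
  unfolding is_topology_def
proof (intro conjI ballI allI impI)
  let ?\<tau> = "one_point_topology X pt"
  note \<tau> = elts_one_point_topology[OF pt]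
  show "vopen ?\<tau> {}" using vopen_elts[of ?\<tau> vempty] unfolding \<tau> by simp
  have "vset (elts X - insert pt (elts X)) = vempty" unfolding vempty_def by (rule arg_cong[where f = vset]) blast
  then show "one_point_points X pt \<in> elts ?\<tau>"
    unfolding \<tau> mem_Collect_eq elts_one_point_points using vfinite_vempty by simp
  fix U V
  show "elts U \<subseteq> elts (one_point_points X pt)" if "U \<in> elts ?\<tau>"
    using that unfolding \<tau> elts_one_point_points by blast
  show "vopen ?\<tau> (elts U \<inter> elts V)" if "U \<in> elts ?\<tau>" "V \<in> elts ?\<tau>"
  proof -
    have "vfinite (vset (elts X - (elts U \<inter> elts V)))" if "pt \<in> elts U" "pt \<in> elts V"
    proof (rule vfinite_subset_Un[of "vset (elts X - elts U)" "vset (elts X - elts V)"])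
      show "elts (vset (elts X - (elts U \<inter> elts V))) \<subseteq> elts (vset (elts X - elts U)) \<union> elts (vset (elts X - elts V))"
        using elts_vset_Diff[of X "vset (elts U \<inter> elts V)"] by auto
    qed (use \<open>U \<in> elts ?\<tau>\<close> \<open>V \<in> elts ?\<tau>\<close> that in \<open>auto simp: \<tau>\<close>)
    then have "vset (elts U \<inter> elts V) \<in> elts ?\<tau>" using that unfolding \<tau> by auto
    then show ?thesis unfolding vopen_def using elts_vset_Int by blast
  qed
next
  let ?\<tau> = "one_point_topology X pt"
  note \<tau> = elts_one_point_topology[OF pt]
  fix \<U> assume U: "elts \<U> \<subseteq> elts ?\<tau>"
  have "vset (\<Union>U\<in>elts \<U>. elts U) \<in> elts ?\<tau>"
    unfolding \<tau> mem_Collect_eq elts_vset_Union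
  proof (intro conjI impI)
    show "(\<Union>U\<in>elts \<U>. elts U) \<subseteq> insert pt (elts X)" using U unfolding \<tau> by blast
    assume "pt \<in> (\<Union>U\<in>elts \<U>. elts U)"
    then obtain V where V: "V \<in> elts \<U>" "pt \<in> elts V" by blast
    then have "vfinite (vset (elts X - elts V))" using U unfolding \<tau> by blast
    moreover have "elts (vset (elts X - (\<Union>U\<in>elts \<U>. elts U))) \<subseteq> elts (vset (elts X - elts V))"
      using elts_vset_Diff[of X "vset (\<Union>U\<in>elts \<U>. elts U)"] V(1) unfolding elts_vset_Union by auto
    ultimately show "vfinite (vset (elts X - (\<Union>U\<in>elts \<U>. elts U)))" by (rule vfinite_subset)
  qed
  then show "vopen ?\<tau> (\<Union>U\<in>elts \<U>. elts U)" unfolding vopen_def using elts_vset_Union by blast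
qed

text \<open>Only intersections containing \<open>pt\<close> need an argument. The complements of the
  sets involved form a countable family of finite subsets of \<open>X\<close>; by hypothesis that
  family is finite, so its union, the complement of the intersection, is finite.\<close>

lemma one_point_P_space:
  assumes pt: "pt \<notin> elts X" and fin: "quasi_dedekind_finite X"
  shows "P_space (one_point_points X pt) (one_point_topology X pt)"
proof (rule P_spaceI[OF one_point_is_topology[OF pt]])
  let ?\<tau> = "one_point_topology X pt"
  note \<tau> = elts_one_point_topology[OF pt]
  fix \<U> assume U: "vcountable \<U>" "elts \<U> \<noteq> {}" "elts \<U> \<subseteq> elts ?\<tau>"
  have "vset (\<Inter>U\<in>elts \<U>. elts U) \<in> elts ?\<tau>"
    unfolding \<tau> mem_Collect_eq elts_vset_INT[OF U(2)]
  proof (intro conjI impI)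
    show "(\<Inter>U\<in>elts \<U>. elts U) \<subseteq> insert pt (elts X)" using U(2,3) unfolding \<tau> by blast
    assume in_all: "pt \<in> (\<Inter>U\<in>elts \<U>. elts U)"
    have "definable (\<lambda>e. e 0 \<in> elts X - elts (e (Suc 0)))"
      unfolding Diff_iff by (intro definable_intros)
    then obtain B where B: "vcountable B" "elts B = {b. \<exists>U\<in>elts \<U>. elts b = elts X - elts U}"
      "elts ` elts B = (\<lambda>U. elts X - elts U) ` elts \<U>"
      by (rule countable_family[where S = "\<lambda>U. elts X - elts U" and X = X, OF U(1)]) auto
    have B_fin: "b \<in> elts (finite_subsets X)" if b: "b \<in> elts B" for b
    proof -
      obtain V where V: "V \<in> elts \<U>" "elts b = elts X - elts V" using b unfolding B(2) by blast
      have "vfinite (vset (elts X - elts V))" using V(1) U(3) in_all unfolding \<tau> by blast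
      then have "vfinite b" unfolding V(2)[symmetric] by simp
      then show ?thesis unfolding elts_finite_subsets using V(2) by blast
    qed
    then have "vfinite B"
      using dedekind_infiniteI[OF B(1)] fin unfolding quasi_dedekind_finite_def by blast
    then show "vfinite (vset (elts X - (\<Inter>U\<in>elts \<U>. elts U)))"
    proof (rule vfinite_Union)
      show "vfinite b" if "b \<in> elts B" for b using B_fin[OF that] unfolding elts_finite_subsets by blast
      show "elts (vset (elts X - (\<Inter>U\<in>elts \<U>. elts U))) \<subseteq> (\<Union>b\<in>elts B. elts b)"
        unfolding B(3) using elts_vset_Diff[of X "vset (\<Inter>U\<in>elts \<U>. elts U)"]
        unfolding elts_vset_INT[OF U(2)] by auto
    qed
  qed
  then show "vopen ?\<tau> (\<Inter>U\<in>elts \<U>. elts U)" unfolding vopen_def using elts_vset_INT[OF U(2)] by blast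
qed

text \<open>An open set containing \<open>pt\<close> is already closed, since its complement lies in
  the discrete part. At any other point the singleton is clopen, its complement being
  cofinite.\<close>

lemma one_point_clopen:
  assumes pt: "pt \<notin> elts X" and U: "U \<in> elts (one_point_topology X pt)"
    and x: "x \<in> elts U"
  shows "\<exists>V. clopen (one_point_points X pt) (one_point_topology X pt) V \<and> x \<in> elts V \<and> elts V \<subseteq> elts U"
proof -
  note \<tau> = elts_one_point_topology[OF pt]
  show ?thesis
  proof (cases "x = pt")
    case True
    have "vset (insert pt (elts X) - elts U) \<in> elts (one_point_topology X pt)"
      using elts_vset_Diff[of "one_point_points X pt" U] True x unfolding \<tau> elts_one_point_points by auto
    then have "clopen (one_point_points X pt) (one_point_topology X pt) U"
      unfolding clopen_def vclosed_def vopen_def using U elts_vset_Diff[of "one_point_points X pt" U]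
      unfolding \<tau> elts_one_point_points by blast
    then show ?thesis using x by blast
  next
    case False
    then have xX: "x \<in> elts X" using x U unfolding \<tau> by blast
    have c: "elts (vset (insert pt (elts X) - {x})) = insert pt (elts X) - {x}"
      using elts_vset_remove[of "one_point_points X pt" x] unfolding elts_one_point_points .
    have "elts X - (insert pt (elts X) - {x}) = {x}" using xX pt by blast
    moreover have "vfinite (vset {x})" using vfinite_insert[OF vfinite_vempty, of x] by simp
    ultimately have "vset (insert pt (elts X) - {x}) \<in> elts (one_point_topology X pt)"
      unfolding \<tau> using c by auto
    moreover have "vset {x} \<in> elts (one_point_topology X pt)"
      unfolding \<tau> using xX pt by auto
    ultimately have "clopen (one_point_points X pt) (one_point_topology X pt) (vset {x})"
      unfolding clopen_def vclosed_def vopen_def elts_one_point_points using c xX by auto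
    then show ?thesis using x by (intro exI[of _ "vset {x}"]) simp
  qed
qed

lemma one_point_T1:
  assumes pt: "pt \<notin> elts X"
  shows "T1 (one_point_points X pt) (one_point_topology X pt)"
  unfolding T1_def
proof (intro ballI impI)
  note \<tau> = elts_one_point_topology[OF pt]
  fix x y assume xy: "x \<in> elts (one_point_points X pt)" "y \<in> elts (one_point_points X pt)" "x \<noteq> y"
  have c: "elts (vset (insert pt (elts X) - {y})) = insert pt (elts X) - {y}"
    using elts_vset_remove[of "one_point_points X pt" y] unfolding elts_one_point_points .
  have "vfinite (vset {y})" using vfinite_insert[OF vfinite_vempty, of y] by simp
  \<comment> \<open>The set in question is \<open>{y}\<close> if \<open>y\<close> lies in
    \<open>X\<close> and empty if \<open>y\<close> is \<open>pt\<close>; inclusion in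
    \<open>{y}\<close> handles both.\<close>
  then have "vfinite (vset (elts X - (insert pt (elts X) - {y})))"
  proof (rule vfinite_subset)
    show "elts (vset (elts X - (insert pt (elts X) - {y}))) \<subseteq> elts (vset {y})"
      using elts_vset_Diff[of X "vset (insert pt (elts X) - {y})"] unfolding c by auto
  qed
  then have "vset (insert pt (elts X) - {y}) \<in> elts (one_point_topology X pt)"
    unfolding \<tau> mem_Collect_eq c by blast
  moreover have "x \<in> elts (vset (insert pt (elts X) - {y}))" "y \<notin> elts (vset (insert pt (elts X) - {y}))"
    using xy unfolding c elts_one_point_points by auto
  ultimately show "\<exists>U\<in>elts (one_point_topology X pt). x \<in> elts U \<and> y \<notin> elts U" by blast
qed

section \<open>Assembly of the thirteen statements\<close>

theorem proposition4p1:
  "(\<forall>X \<tau> :: 'v::zf. is_topology X \<tau> \<longrightarrow>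
      (P_space X \<tau> \<longleftrightarrow> (\<forall>G. G_delta \<tau> G \<longrightarrow> G \<in> elts \<tau>))) \<and>
   (\<forall>X \<tau> :: 'v. P_space X \<tau> \<longrightarrow>
      (\<forall>R Z. complete_ordered_field R \<and> zero_set R X \<tau> Z \<longrightarrow> Z \<in> elts \<tau>) \<and>
      (\<forall>Z. c_delta X \<tau> Z \<longrightarrow> Z \<in> elts \<tau>)) \<and>

   (\<forall>X \<tau> Y :: 'v. P_space X \<tau> \<and> elts Y \<subseteq> elts X \<longrightarrow>
      P_space Y (subspace_topology \<tau> Y)) \<and>

   (\<forall>J S T :: 'v. (\<exists>B. vfun S J B) \<and> (\<exists>B. vfun T J B) \<and>
        (\<forall>j\<in>elts J. P_space (app S j) (app T j)) \<longrightarrow>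
      P_space (sum_points J S) (sum_topology J S T)) \<and>

   (\<forall>(R :: 'v real_struct) X \<tau>. complete_ordered_field R \<and>
        completely_regular R X \<tau> \<and> P_space X \<tau> \<longrightarrow>
      strongly_zero_dimensional R X \<tau>) \<and>

   (\<forall>(R :: 'v real_struct) X \<tau>. complete_ordered_field R \<and> P_space X \<tau> \<longrightarrow>
      C_disc R X \<tau> = C R X \<tau>) \<and>

   (\<forall>X \<tau> :: 'v. P_space X \<tau> \<longrightarrow> (baire \<tau> \<longleftrightarrow> strongly_baire \<tau>)) \<and>

   (\<forall>X \<tau> Y :: 'v. is_topology X \<tau> \<and> T1 X \<tau> \<and> elts Y \<subseteq> elts X \<and> cuf Y \<and>
        (\<exists>x. accumulation_point X \<tau> Y x) \<longrightarrow>
      \<not> P_space X \<tau>) \<and>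

   (\<forall>X \<tau> Y :: 'v. T1 X \<tau> \<and> P_space X \<tau> \<and> elts Y \<subseteq> elts X \<and> cuf Y \<longrightarrow>
      vclosed X \<tau> Y \<and> discrete_space Y (subspace_topology \<tau> Y)) \<and>

   (\<forall>X \<tau> :: 'v. is_topology X \<tau> \<and> weakly_dedekind_finite X \<longrightarrow> P_space X \<tau>) \<and>

   (\<forall>X pt :: 'v. \<not> vfinite X \<and> quasi_dedekind_finite X \<and> pt \<notin> elts X \<longrightarrow>
      P_space (one_point_points X pt) (one_point_topology X pt) \<and>
      (\<forall>R. complete_ordered_field R \<longrightarrow>
         tychonoff R (one_point_points X pt) (one_point_topology X pt))) \<and>

   (\<forall>X \<tau> :: 'v. first_countable X \<tau> \<and> T1 X \<tau> \<and> P_space X \<tau> \<longrightarrow> discrete_space X \<tau>) \<and>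
   (\<forall>(R :: 'v real_struct) X \<tau>. complete_ordered_field R \<and> metrizable R X \<tau> \<and> P_space X \<tau> \<longrightarrow>
      discrete_space X \<tau>) \<and>

   (\<forall>X \<tau> :: 'v. is_topology X \<tau> \<longrightarrow>
      vbase \<tau> (vset (elts \<tau> - {vempty})) \<and>
      (P_space X \<tau> \<longleftrightarrow> almost_stable (vset (elts \<tau> - {vempty})))) \<and>

   (\<forall>X \<tau> Y :: 'v. T1 X \<tau> \<and> P_space X \<tau> \<and> elts Y \<subseteq> elts X \<and> vcountable Y \<longrightarrow>
      discrete_space Y (subspace_topology \<tau> Y) \<and> vclosed X \<tau> Y) \<and>
   (\<forall>X \<tau> :: 'v. separable X \<tau> \<and> T1 X \<tau> \<and> P_space X \<tau> \<longrightarrow>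
      discrete_space X \<tau> \<and> vcountable X)"
proof (intro conjI allI impI)
  fix X \<tau> Y J S T pt Z G :: 'v and R :: "'v real_struct"
  show "P_space X \<tau> \<longleftrightarrow> (\<forall>G. G_delta \<tau> G \<longrightarrow> G \<in> elts \<tau>)" if "is_topology X \<tau>"
    using that by (rule P_space_iff)
  show "Z \<in> elts \<tau>" if "P_space X \<tau>" "complete_ordered_field R \<and> zero_set R X \<tau> Z"
    using real_line.zero_set_clopen[of R X \<tau> Z] that unfolding real_line_def clopen_def by blast
  show "Z \<in> elts \<tau>" if "P_space X \<tau>" "c_delta X \<tau> Z"
  proof -
    have "G_delta \<tau> Z" using that(2) unfolding c_delta_def G_delta_def clopen_def by blast
    then show ?thesis using that(1) P_space_iff P_space_topology by blast
  qed
  show "P_space Y (subspace_topology \<tau> Y)" if "P_space X \<tau> \<and> elts Y \<subseteq> elts X"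
    using that P_space_subspace by blast
  show "P_space (sum_points J S) (sum_topology J S T)"
    if "(\<exists>B. vfun S J B) \<and> (\<exists>B. vfun T J B) \<and> (\<forall>j\<in>elts J. P_space (app S j) (app T j))"
    using that P_space_sum by blast
  show "strongly_zero_dimensional R X \<tau>"
    if "complete_ordered_field R \<and> completely_regular R X \<tau> \<and> P_space X \<tau>"
    using real_line.P_space_strongly_zero_dimensional[of R X \<tau>] that unfolding real_line_def by blast
  show "C_disc R X \<tau> = C R X \<tau>" if "complete_ordered_field R \<and> P_space X \<tau>"
    using real_line.C_disc_eq[of R X \<tau>] that unfolding real_line_def by blast
  show "baire \<tau> \<longleftrightarrow> strongly_baire \<tau>" if "P_space X \<tau>"
    using that by (rule P_space_baire_iff)
  show "\<not> P_space X \<tau>"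
    if "is_topology X \<tau> \<and> T1 X \<tau> \<and> elts Y \<subseteq> elts X \<and> cuf Y \<and> (\<exists>x. accumulation_point X \<tau> Y x)"
    using that cuf_no_accumulation_point by blast
  show "vclosed X \<tau> Y" "discrete_space Y (subspace_topology \<tau> Y)"
    if "T1 X \<tau> \<and> P_space X \<tau> \<and> elts Y \<subseteq> elts X \<and> cuf Y"
    using that cuf_closed_discrete[of X \<tau> Y] by blast+
  show "P_space X \<tau>" if "is_topology X \<tau> \<and> weakly_dedekind_finite X"
    using that P_space_weakly_dedekind_finite by blast
  show one_point: "P_space (one_point_points X pt) (one_point_topology X pt)"
    if "\<not> vfinite X \<and> quasi_dedekind_finite X \<and> pt \<notin> elts X" for X pt
    using that one_point_P_space by blast
  show "tychonoff R (one_point_points X pt) (one_point_topology X pt)"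
    if X: "\<not> vfinite X \<and> quasi_dedekind_finite X \<and> pt \<notin> elts X" and R: "complete_ordered_field R"
    unfolding tychonoff_def
  proof
    have pt: "pt \<notin> elts X" using X by blast
    show "T1 (one_point_points X pt) (one_point_topology X pt)" by (rule one_point_T1[OF pt])
    show "completely_regular R (one_point_points X pt) (one_point_topology X pt)"
      by (rule real_line.P_space_completely_regularI[OF _ one_point[OF X] one_point_clopen[OF pt]])
        (use R in \<open>simp add: real_line_def\<close>)
  qed
  show "discrete_space X \<tau>" if "first_countable X \<tau> \<and> T1 X \<tau> \<and> P_space X \<tau>"
    using that first_countable_P_space by blast
  show "discrete_space X \<tau>" if "complete_ordered_field R \<and> metrizable R X \<tau> \<and> P_space X \<tau>"
    using real_line.metrizable_P_space[of R X \<tau>] that unfolding real_line_def by blast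
  show "vbase \<tau> (vset (elts \<tau> - {vempty}))"
    by (rule vbase_nonempty_opens)
  show "P_space X \<tau> \<longleftrightarrow> almost_stable (vset (elts \<tau> - {vempty}))" if "is_topology X \<tau>"
    using that by (rule P_space_almost_stable_iff)
  show "discrete_space Y (subspace_topology \<tau> Y)" "vclosed X \<tau> Y"
    if "T1 X \<tau> \<and> P_space X \<tau> \<and> elts Y \<subseteq> elts X \<and> vcountable Y"
    using that cuf_closed_discrete[of X \<tau> Y] vcountable_imp_cuf by blast+
  show "discrete_space X \<tau>" "vcountable X" if "separable X \<tau> \<and> T1 X \<tau> \<and> P_space X \<tau>"
    using that separable_P_space[of X \<tau>] by blast+
qed

end
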